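(* Let $\mathbf{L}$ be either the standard Łukasiewicz algebra or the standard product algebra. Then for each finite theory $\Sigma$ and any formula $A\Rightarrow B$, the degree $c=|A\Rightarrow B|_\Sigma$ is rational and $\Sigma\vdash A\Rightarrow c\otimes B$. Moreover, the logic based on either of these algebras is decidable: there is an algorithm that, given a finite theory $\Sigma$ and a formula $A\Rightarrow B$, decides whether $\Sigma\vdash A\Rightarrow B$.
   Context: The standard Łukasiewicz algebra is $[0,1]$ with min, max, $a\otimes b=\max\{0,a+b-1\}$, $a\rightarrow b=\min\{1,1-a+b\}$; the standard product algebra is $[0,1]$ with min, max, $a\otimes b=ab$, $a\rightarrow b=1$ if $a\le b$ and $b/a$ otherwise. $[0,1]_\mathbb{Q}$ denotes the rationals in $[0,1]$. An $\mathbf{L}$-set in a set $U$ is a map $U\to[0,1]$; finite if its support $\{u:A(u)>0\}$ is finite, rational if all values are rational. Unions are pointwise suprema, $(c\otimes A)(u)=c\otimes A(u)$, $A\subseteq B$ means pointwise $\le$, $S(A,B)=\bigwedge_{u}(A(u)\rightarrow B(u))$. Fix a denumerable set $\mathrm{Var}$ of propositional variables. A formula is $A\Rightarrow B$ with $A,B$ finite rational $\mathbf{L}$-sets in $\mathrm{Var}$. A theory is a set of formulas. Deductive system: axioms are all $A\cup B\Rightarrow B$; rules (Cut): from $A\Rightarrow B$ and $B\cup C\Rightarrow D$ infer $A\cup C\Rightarrow D$; (Mul): from $A\Rightarrow B$ infer $c\otimes A\Rightarrow c\otimes B$ for $c\in[0,1]_\mathbb{Q}$. $\Sigma\vdash A\Rightarrow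 B$ means there is a finite sequence of formulas ending in $A\Rightarrow B$, each an axiom, a member of $\Sigma$, or obtained from earlier members by one rule application. The provability degree is $|A\Rightarrow B|_\Sigma=\bigvee\{c\in[0,1]_\mathbb{Q}:\Sigma\vdash A\Rightarrow c\otimes B\}$. *)

theory Defs
  imports Complex_Main "HOL-Library.Nat_Bijection"
begin

subsection \<open>The two standard algebras on the unit interval\<close>

text \<open>The carrier is \<open>{0..1}\<close> with \<open>min\<close> and \<open>max\<close> in both cases; only the adjoint pair varies.\<close>

record std_algebra =
  tensor :: "real \<Rightarrow> real \<Rightarrow> real"
  residuum :: "real \<Rightarrow> real \<Rightarrow> real"

definition lukasiewicz_algebra :: std_algebra where
  "lukasiewicz_algebra =
     \<lparr> tensor = (\<lambda>a b. max 0 (a + b - 1)), residuum = (\<lambda>a b. min 1 (1 - a + b)) \<rparr>"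

definition product_algebra :: std_algebra where
  "product_algebra =
     \<lparr> tensor = (\<lambda>a b. a * b), residuum = (\<lambda>a b. if a \<le> b then 1 else b / a) \<rparr>"

abbreviation unit_rats :: "real set" where
  "unit_rats \<equiv> {0..1} \<inter> \<rat>"


subsection \<open>L-sets and formulas\<close>

type_synonym 'v lset = "'v \<Rightarrow> real"

definition finite_rational_lsets :: "'v lset set" where
  "finite_rational_lsets = {A. (\<forall>u. A u \<in> unit_rats) \<and> finite {u. A u > 0}}"

definition lunion :: "'v lset \<Rightarrow> 'v lset \<Rightarrow> 'v lset" where
  "lunion A B = (\<lambda>u. max (A u) (B u))"

definition lscale :: "std_algebra \<Rightarrow> real \<Rightarrow> 'v lset \<Rightarrow> 'v lset" where
  "lscale L c A = (\<lambda>u. tensor L c (A u))"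

text \<open>The pair \<open>(A, B)\<close> stands for the formula \<open>A \<Rightarrow> B\<close>.\<close>

type_synonym 'v fml = "'v lset \<times> 'v lset"

definition formulas :: "'v fml set" where
  "formulas = finite_rational_lsets \<times> finite_rational_lsets"


subsection \<open>Provability\<close>

definition is_axiom :: "'v fml \<Rightarrow> bool" where
  "is_axiom \<phi> \<longleftrightarrow>
     (\<exists>A\<in>finite_rational_lsets. \<exists>B\<in>finite_rational_lsets. \<phi> = (lunion A B, B))"

definition by_cut :: "'v fml \<Rightarrow> 'v fml \<Rightarrow> 'v fml \<Rightarrow> bool" where
  "by_cut \<phi> \<psi> \<chi> \<longleftrightarrow>
     (\<exists>A\<in>finite_rational_lsets. \<exists>B\<in>finite_rational_lsets.
      \<exists>C\<in>finite_rational_lsets. \<exists>D\<in>finite_rational_lsets.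
        \<phi> = (A, B) \<and> \<psi> = (lunion B C, D) \<and> \<chi> = (lunion A C, D))"

definition by_mul :: "std_algebra \<Rightarrow> 'v fml \<Rightarrow> 'v fml \<Rightarrow> bool" where
  "by_mul L \<phi> \<chi> \<longleftrightarrow>
     (\<exists>A\<in>finite_rational_lsets. \<exists>B\<in>finite_rational_lsets. \<exists>c\<in>unit_rats.
        \<phi> = (A, B) \<and> \<chi> = (lscale L c A, lscale L c B))"

definition is_proof :: "std_algebra \<Rightarrow> 'v fml set \<Rightarrow> 'v fml list \<Rightarrow> bool" where
  "is_proof L \<Sigma> ps \<longleftrightarrow>
     set ps \<subseteq> formulas \<and>
     (\<forall>i<length ps.
        is_axiom (ps ! i) \<or> ps ! i \<in> \<Sigma> \<or>
        (\<exists>j<i. \<exists>k<i. by_cut (ps ! j) (ps ! k) (ps ! i)) \<or>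
        (\<exists>j<i. by_mul L (ps ! j) (ps ! i)))"

definition provable :: "std_algebra \<Rightarrow> 'v fml set \<Rightarrow> 'v fml \<Rightarrow> bool" where
  "provable L \<Sigma> \<phi> \<longleftrightarrow> (\<exists>ps. is_proof L \<Sigma> ps \<and> ps \<noteq> [] \<and> last ps = \<phi>)"

definition provability_degree :: "std_algebra \<Rightarrow> 'v fml set \<Rightarrow> 'v lset \<Rightarrow> 'v lset \<Rightarrow> real" where
  "provability_degree L \<Sigma> A B = Sup {c \<in> unit_rats. provable L \<Sigma> (A, lscale L c B)}"


subsection \<open>Recursive functions and decidability\<close>

text \<open>
  Total general recursive functions of a given arity: the least class containing the zero
  functions, successor and the projections and closed under composition, primitive recursion
  and minimization of regular functions. An \<open>n\<close>-ary function is represented by a function on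
  lists; its values on lists of length other than \<open>n\<close> are irrelevant.
\<close>

inductive recursive_fun :: "nat \<Rightarrow> (nat list \<Rightarrow> nat) \<Rightarrow> bool" where
  zero_fn: "recursive_fun n (\<lambda>xs. 0)"
| Suc_fn: "recursive_fun 1 (\<lambda>xs. Suc (xs ! 0))"
| proj: "i < n \<Longrightarrow> recursive_fun n (\<lambda>xs. xs ! i)"
| comp: "recursive_fun (length hs) g \<Longrightarrow> (\<And>h. h \<in> set hs \<Longrightarrow> recursive_fun n h) \<Longrightarrow>
           recursive_fun n (\<lambda>xs. g (map (\<lambda>h. h xs) hs))"
| prim_rec: "recursive_fun n g \<Longrightarrow> recursive_fun (Suc (Suc n)) h \<Longrightarrow>
           recursive_fun (Suc n)
             (\<lambda>xs. rec_nat (g (tl xs)) (\<lambda>k r. h (k # r # tl xs)) (hd xs))"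
| minimize: "recursive_fun (Suc n) g \<Longrightarrow> (\<And>xs. length xs = n \<Longrightarrow> \<exists>y. g (y # xs) = 0) \<Longrightarrow>
           recursive_fun n (\<lambda>xs. LEAST y. g (y # xs) = 0)"

definition decidable_on :: "('a \<Rightarrow> nat) \<Rightarrow> 'a set \<Rightarrow> ('a \<Rightarrow> bool) \<Rightarrow> bool" where
  "decidable_on code D P \<longleftrightarrow>
     (\<exists>f. recursive_fun 1 f \<and> (\<forall>x\<in>D. f [code x] = (if P x then 1 else 0)))"


subsection \<open>Finite theories and formulas as inputs\<close>

text \<open>
  A rational in \<open>{0..1}\<close> is coded by its reduced numerator and denominator, a finite L-set by
  the finite set of its pairs (variable, nonzero value), where \<open>e\<close> numbers the variables.
\<close>

definition unit_rat_code :: "real \<Rightarrow> nat" where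
  "unit_rat_code x = (case quotient_of (the_inv of_rat x) of (p, q) \<Rightarrow> prod_encode (nat p, nat q))"

definition lset_code :: "('v \<Rightarrow> nat) \<Rightarrow> 'v lset \<Rightarrow> nat" where
  "lset_code e A = set_encode ((\<lambda>u. prod_encode (e u, unit_rat_code (A u))) ` {u. A u > 0})"

definition formula_code :: "('v \<Rightarrow> nat) \<Rightarrow> 'v fml \<Rightarrow> nat" where
  "formula_code e \<phi> = prod_encode (lset_code e (fst \<phi>), lset_code e (snd \<phi>))"

definition entailment_code :: "('v \<Rightarrow> nat) \<Rightarrow> 'v fml set \<times> 'v fml \<Rightarrow> nat" where
  "entailment_code e p = prod_encode (set_encode (formula_code e ` fst p), formula_code e (snd p))"

definition finite_theories :: "'v fml set set" where
  "finite_theories = {\<Sigma>. finite \<Sigma> \<and> \<Sigma> \<subseteq> formulas}"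

lemma inj_on_unit_rat_code: "inj_on unit_rat_code unit_rats"
proof (rule inj_onI)
  fix x y :: real
  assume x: "x \<in> unit_rats" and y: "y \<in> unit_rats" and eq: "unit_rat_code x = unit_rat_code y"
  obtain a b where ab: "x = of_rat a" "y = of_rat b" using x y by (auto elim!: Rats_cases)
  have inv: "the_inv real_of_rat (of_rat r) = r" for r
    by (rule the_inv_f_f) (simp add: inj_on_def)
  obtain p q p' q' where pq: "quotient_of a = (p, q)" "quotient_of b = (p', q')"
    by (metis surj_pair)
  have den: "q > 0" "q' > 0" using pq quotient_of_denom_pos by blast+
  have "a = of_int p / of_int q" "b = of_int p' / of_int q'"
    using pq quotient_of_div by blast+
  moreover have "a \<ge> 0" "b \<ge> 0" using x y ab by auto
  ultimately have num: "p \<ge> 0" "p' \<ge> 0"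
    using den by (auto simp: zero_le_divide_iff)
  have "nat p = nat p'" "nat q = nat q'"
    using eq unfolding ab unit_rat_code_def inv pq by (auto simp: prod_encode_eq)
  then have "quotient_of a = quotient_of b" using num den pq by auto
  then show "x = y" using ab by (simp add: quotient_of_inject_eq)
qed

lemma inj_on_lset_code:
  assumes "inj e"
  shows "inj_on (lset_code e) finite_rational_lsets"
proof (rule inj_onI)
  fix A B :: "'a lset"
  assume A: "A \<in> finite_rational_lsets" and B: "B \<in> finite_rational_lsets"
    and eq: "lset_code e A = lset_code e B"
  let ?S = "\<lambda>A. (\<lambda>u. prod_encode (e u, unit_rat_code (A u))) ` {u. A u > 0}"
  have S: "?S A = ?S B"
    using eq A B unfolding lset_code_def finite_rational_lsets_def
    by (subst (asm) set_encode_eq) auto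
  have graph: "A' u = B' u" if "?S A' \<subseteq> ?S B'" "A' u > 0"
    "A' \<in> finite_rational_lsets" "B' \<in> finite_rational_lsets" for A' B' u
  proof -
    have "prod_encode (e u, unit_rat_code (A' u)) \<in> ?S B'" using that by blast
    then have "unit_rat_code (A' u) = unit_rat_code (B' u)"
      using assms by (auto simp: prod_encode_eq dest: injD)
    then show ?thesis
      using that inj_on_unit_rat_code unfolding finite_rational_lsets_def
      by (auto dest: inj_onD)
  qed
  show "A = B"
  proof
    fix u
    have "A u \<ge> 0" "B u \<ge> 0" using A B by (auto simp: finite_rational_lsets_def)
    then show "A u = B u"
      using graph[of A B u] graph[of B A u] S A B by fastforce
  qed
qed

lemma inj_on_formula_code:
  assumes "inj e"
  shows "inj_on (formula_code e) formulas"
  using inj_on_lset_code[OF assms]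
  by (auto simp: inj_on_def formula_code_def formulas_def prod_encode_eq)

lemma inj_on_entailment_code:
  assumes "inj e"
  shows "inj_on (entailment_code e) (finite_theories \<times> formulas)"
proof (rule inj_onI)
  fix p p' :: "'a fml set \<times> 'a fml"
  assume p: "p \<in> finite_theories \<times> formulas" "p' \<in> finite_theories \<times> formulas"
    and eq: "entailment_code e p = entailment_code e p'"
  have "formula_code e ` fst p = formula_code e ` fst p'"
  proof (rule iffD1[OF set_encode_eq])
    show "finite (formula_code e ` fst p)" "finite (formula_code e ` fst p')"
      using p by (auto simp: finite_theories_def)
    show "set_encode (formula_code e ` fst p) = set_encode (formula_code e ` fst p')"
      using eq by (simp add: entailment_code_def prod_encode_eq)
  qed
  then have "fst p = fst p'"
    by (rule iffD1[OF inj_on_image_eq_iff[OF inj_on_formula_code[OF assms]], rotated 2])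
      (use p in \<open>auto simp: finite_theories_def\<close>)
  moreover have "snd p = snd p'"
    by (rule inj_onD[OF inj_on_formula_code[OF assms]])
      (use eq p in \<open>auto simp: entailment_code_def prod_encode_eq\<close>)
  ultimately show "p = p'" by (rule prod_eqI)
qed

end

theory Submission imports Defs begin

text \<open>
  Starting from \<open>A\<close>, repeatedly replace \<open>M\<close> by \<open>M \<union> S(C, M) \<otimes> D\<close> for members \<open>C \<Rightarrow> D\<close> of the
  theory. Every \<open>M\<close> obtained in this way is a finite rational \<open>L\<close>-set with \<open>A \<Rightarrow> M\<close> provable, and
  once no step changes \<open>M\<close> any more, \<open>M\<close> is a model of the theory, so by soundness \<open>A \<Rightarrow> B\<close> is
  provable iff \<open>B \<subseteq> M\<close>; in particular the provability degree is \<open>S(B, M)\<close>, which is rational and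
  attained.

  The iteration stops. A value that changes becomes one of finitely many constants, or arises from
  another value by one of finitely many maps, which are translations (Lukasiewicz) or dilations
  (product). If some values changed forever, then from some stage on only maps used infinitely
  often would occur; these send limits to limits, and so they preserve the differences,
  respectively the quotients, between the values and their limits. Hence only finitely many values
  could occur, a contradiction.

  For decidability, both answers have finite certificates that can be checked by bounded
  quantification: a ranked set of derived degrees, or the graph of a rational model of the theory
  in which \<open>A\<close> holds but \<open>B\<close> fails. A minimization searches for a certificate of either kind.
\<close>

section \<open>Computable functions and predicates\<close>

text \<open>\<open>recursive_fun\<close> concerns one fixed function on all lists, including those
  of the wrong length. Comparing values only at length \<open>n\<close> allows convenient forms such
  as \<open>hd\<close> and \<open>tl\<close> to be used freely.\<close>

definition computable :: "nat \<Rightarrow> (nat list \<Rightarrow> nat) \<Rightarrow> bool" where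
  "computable n f \<longleftrightarrow> (\<exists>g. recursive_fun n g \<and> (\<forall>xs. length xs = n \<longrightarrow> g xs = f xs))"

definition decidable :: "nat \<Rightarrow> (nat list \<Rightarrow> bool) \<Rightarrow> bool" where
  "decidable n P \<longleftrightarrow> computable n (\<lambda>xs. if P xs then 1 else 0)"

lemma computable_comp:
  assumes "computable (length hs) g" and "\<And>h. h \<in> set hs \<Longrightarrow> computable n h"
  shows "computable n (\<lambda>xs. g (map (\<lambda>h. h xs) hs))"
proof -
  obtain G where G: "recursive_fun (length hs) G" "\<And>xs. length xs = length hs \<Longrightarrow> G xs = g xs"
    using assms(1) unfolding computable_def by auto
  obtain H where H: "\<And>h. h \<in> set hs \<Longrightarrow> recursive_fun n (H h)"
      "\<And>h xs. h \<in> set hs \<Longrightarrow> length xs = n \<Longrightarrow> H h xs = h xs"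
    using assms(2) unfolding computable_def by metis
  have "recursive_fun n (\<lambda>xs. G (map (\<lambda>h. h xs) (map H hs)))"
    by (rule recursive_fun.comp) (use G H in auto)
  moreover have "G (map (\<lambda>h. h xs) (map H hs)) = g (map (\<lambda>h. h xs) hs)" if "length xs = n" for xs
    using H(2)[OF _ that] G(2) by (simp add: o_def cong: map_cong)
  ultimately show ?thesis unfolding computable_def by blast
qed

lemma computable_cong:
  assumes "computable n f" and "\<And>xs. length xs = n \<Longrightarrow> f xs = g xs"
  shows "computable n g"
  using assms unfolding computable_def by metis

lemma computable_recursive: "recursive_fun n f \<Longrightarrow> computable n f"
  unfolding computable_def by blast

lemma computable_0: "computable n (\<lambda>xs. 0)"
  by (intro computable_recursive recursive_fun.intros)

lemma computable_Suc:
  assumes "computable n f"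
  shows "computable n (\<lambda>xs. Suc (f xs))"
  using computable_comp[of "[f]" "\<lambda>xs. Suc (xs ! 0)" n] assms
    computable_recursive[OF recursive_fun.Suc_fn] by simp

lemma computable_nth: "i < n \<Longrightarrow> computable n (\<lambda>xs. xs ! i)"
  by (intro computable_recursive recursive_fun.proj)

lemma computable_hd: "computable (Suc n) hd"
  by (rule computable_cong[OF computable_nth[of 0]]) (auto simp: length_Suc_conv)

text \<open>Recursion, search and quantifiers put their bound variable in front of the arguments.
  This is the weakening that lets outer variables be mentioned under such a binder.\<close>

lemma computable_tl:
  assumes "computable n f"
  shows "computable (Suc n) (\<lambda>xs. f (tl xs))"
proof -
  let ?hs = "map (\<lambda>i xs. xs ! Suc i) [0..<n]"
  have "computable (Suc n) (\<lambda>xs. f (map (\<lambda>h. h xs) ?hs))"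
    by (rule computable_comp)
      (use assms in \<open>auto intro!: computable_nth\<close>)
  moreover have "map (\<lambda>h. h xs) ?hs = tl xs" if "length xs = Suc n" for xs :: "nat list"
    using that by (intro nth_equalityI) (auto simp: nth_tl)
  ultimately show ?thesis by (elim computable_cong) simp
qed

text \<open>The schema \<open>prim_rec\<close> recurses on the first argument and keeps the others
  as parameters. Composing it with \<open>b\<close> followed by all projections gives recursion up
  to a computed bound with the whole list still available.\<close>

lemma computable_rec_nat:
  assumes "computable n a"
    and "computable (Suc (Suc n)) (\<lambda>ys. h (hd ys) (hd (tl ys)) (tl (tl ys)))"
    and "computable n b"
  shows "computable n (\<lambda>xs. rec_nat (a xs) (\<lambda>k r. h k r xs) (b xs))"
proof -
  obtain ga gh where g: "recursive_fun n ga" "\<And>xs. length xs = n \<Longrightarrow> ga xs = a xs"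
    "recursive_fun (Suc (Suc n)) gh"
    "\<And>xs. length xs = Suc (Suc n) \<Longrightarrow> gh xs = h (hd xs) (hd (tl xs)) (tl (tl xs))"
    using assms(1,2) unfolding computable_def by metis
  let ?R = "\<lambda>xs. rec_nat (ga (tl xs)) (\<lambda>k r. gh (k # r # tl xs)) (hd xs)"
  let ?hs = "b # map (\<lambda>i xs. xs ! i) [0..<n]"
  have "computable n (\<lambda>xs. ?R (map (\<lambda>h. h xs) ?hs))"
  proof (rule computable_comp)
    show "computable (length ?hs) ?R"
      using recursive_fun.prim_rec[OF g(1,3)] by (auto intro: computable_recursive)
    show "computable n h" if "h \<in> set ?hs" for h
      using that assms(3) by (auto intro: computable_nth)
  qed
  moreover have "?R (map (\<lambda>h. h xs) ?hs) = rec_nat (a xs) (\<lambda>k r. h k r xs) (b xs)"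
    if "length xs = n" for xs
  proof -
    have "map (\<lambda>h. h xs) ?hs = b xs # xs"
      using that by (auto simp: o_def map_nth)
    then show ?thesis using that g by simp
  qed
  ultimately show ?thesis by (rule computable_cong)
qed

section \<open>Arithmetic, decidable relations and search\<close>

lemma computable_add:
  assumes "computable n f" and "computable n g"
  shows "computable n (\<lambda>xs. f xs + g xs)"
proof -
  have "rec_nat m (\<lambda>k r. Suc r) l = m + l" for m l :: nat by (induction l) auto
  then show ?thesis
    using computable_rec_nat[of n f "\<lambda>k r xs. Suc r" g] assms
    by (simp add: computable_Suc computable_tl[OF computable_hd])
qed

lemma computable_mult:
  assumes "computable n f" and "computable n g"
  shows "computable n (\<lambda>xs. f xs * g xs)"
proof -
  have "rec_nat 0 (\<lambda>k r. r + m) l = m * l" for m l :: nat by (induction l) auto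
  then show ?thesis
    using computable_rec_nat[of n "\<lambda>_. 0" "\<lambda>k r xs. r + f xs" g, OF computable_0
        computable_add[OF computable_tl[OF computable_hd] computable_tl[OF computable_tl]]] assms
    by simp
qed

lemma computable_diff:
  assumes "computable n f" and "computable n g"
  shows "computable n (\<lambda>xs. f xs - g xs)"
proof -
  have pred: "computable n (\<lambda>xs. f xs - 1)" if "computable n f" for n f
  proof -
    have "rec_nat 0 (\<lambda>k r. k) l = l - 1" for l :: nat by (induction l) auto
    then show ?thesis
      using computable_rec_nat[of n "\<lambda>_. 0" "\<lambda>k r xs. k" f] that
      by (simp add: computable_0 computable_hd)
  qed
  have "rec_nat m (\<lambda>k r. r - 1) l = m - l" for m l :: nat by (induction l) auto
  then show ?thesis
    using computable_rec_nat[of n f "\<lambda>k r xs. r - 1" g] assms pred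
    by (simp add: computable_tl computable_hd)
qed

lemma computable_power_2:
  assumes "computable n f"
  shows "computable n (\<lambda>xs. 2 ^ f xs)"
proof -
  have "rec_nat 1 (\<lambda>k r. r + r) l = (2 :: nat) ^ l" for l :: nat by (induction l) auto
  then show ?thesis
    using computable_rec_nat[of n "\<lambda>_. 1" "\<lambda>k r xs. r + r" f] assms
    by (simp add: computable_0 computable_Suc computable_add computable_tl computable_hd)
qed

text \<open>Case distinction is a recursion of at most one step, the characteristic value being the
  number of steps.\<close>

lemma computable_if:
  assumes "decidable n P" and "computable n f" and "computable n g"
  shows "computable n (\<lambda>xs. if P xs then f xs else g xs)"
proof -
  have "rec_nat m (\<lambda>k r. l) (if b then 1 else 0) = (if b then l else m)" for m l :: nat and b
    by auto
  then show ?thesis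
    using computable_rec_nat[of n g "\<lambda>k r xs. f xs" "\<lambda>xs. if P xs then 1 else 0",
        OF _ computable_tl[OF computable_tl]] assms
    by (simp add: decidable_def)
qed

lemma decidable_not:
  assumes "decidable n P"
  shows "decidable n (\<lambda>xs. \<not> P xs)"
  using computable_if[OF assms computable_0 computable_Suc[OF computable_0]]
  unfolding decidable_def by (rule computable_cong) auto

lemma decidable_conj:
  assumes "decidable n P" and "decidable n Q"
  shows "decidable n (\<lambda>xs. P xs \<and> Q xs)"
  using computable_if[OF assms(1) assms(2)[unfolded decidable_def] computable_0]
  unfolding decidable_def by (rule computable_cong) auto

lemma decidable_disj:
  assumes "decidable n P" and "decidable n Q"
  shows "decidable n (\<lambda>xs. P xs \<or> Q xs)"
  using decidable_not[OF decidable_conj[OF decidable_not[OF assms(1)] decidable_not[OF assms(2)]]]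
  by simp

lemma decidable_imp:
  assumes "decidable n P" and "decidable n Q"
  shows "decidable n (\<lambda>xs. P xs \<longrightarrow> Q xs)"
  using decidable_disj[OF decidable_not[OF assms(1)] assms(2)] by simp

text \<open>Truncated subtraction turns the comparison into a test for zero.\<close>

lemma decidable_le:
  assumes "computable n f" and "computable n g"
  shows "decidable n (\<lambda>xs. f xs \<le> g xs)"
proof -
  have "rec_nat 1 (\<lambda>k r. 0) (m - l) = (if m \<le> l then 1 else (0 :: nat))" for m l :: nat
    by (cases "m - l") auto
  then show ?thesis
    using computable_rec_nat[of n "\<lambda>_. 1" "\<lambda>k r xs. 0" "\<lambda>xs. f xs - g xs"] assms
    by (simp add: decidable_def computable_0 computable_Suc computable_diff)
qed

lemma decidable_less:
  assumes "computable n f" and "computable n g"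
  shows "decidable n (\<lambda>xs. f xs < g xs)"
  using decidable_not[OF decidable_le[OF assms(2,1)]] by (simp add: not_le)

lemma decidable_eq:
  assumes "computable n f" and "computable n g"
  shows "decidable n (\<lambda>xs. f xs = g xs)"
  using decidable_conj[OF decidable_le[OF assms] decidable_le[OF assms(2,1)]]
  by (simp add: order_eq_iff)

lemma decidable_bounded_ex:
  assumes "decidable (Suc n) (\<lambda>ys. Q (hd ys) (tl ys))" and "computable n b"
  shows "decidable n (\<lambda>xs. \<exists>y<b xs. Q y xs)"
proof -
  have eq: "rec_nat 0 (\<lambda>k r. if P k then 1 else r) l = (if \<exists>y<l. P y then 1 else (0 :: nat))"
    for P and l :: nat
    by (induction l) (auto simp: less_Suc_eq)
  \<comment> \<open>In the recursion the accumulated value stands between the counter and the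
    parameters, so \<open>Q\<close> has to skip the second argument.\<close>
  have "decidable (Suc (Suc n)) (\<lambda>ys. Q (hd ys) (tl (tl ys)))"
  proof -
    let ?hs = "hd # map (\<lambda>i xs. xs ! Suc (Suc i)) [0..<n]"
    have "computable (Suc (Suc n))
        (\<lambda>xs. if Q (hd (map (\<lambda>h. h xs) ?hs)) (tl (map (\<lambda>h. h xs) ?hs)) then 1 else 0)"
    proof (rule computable_comp)
      show "computable (length ?hs) (\<lambda>ys. if Q (hd ys) (tl ys) then 1 else 0)"
        using assms(1) by (simp add: decidable_def)
      show "computable (Suc (Suc n)) h" if "h \<in> set ?hs" for h
        using that by (auto intro: computable_hd computable_nth)
    qed
    moreover have "map (\<lambda>h. h xs) ?hs = hd xs # tl (tl xs)" if "length xs = Suc (Suc n)"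
      for xs :: "nat list"
    proof -
      have "map (\<lambda>i. xs ! Suc (Suc i)) [0..<n] = tl (tl xs)"
        using that by (intro nth_equalityI) (auto simp: nth_tl)
      then show ?thesis by (simp add: o_def)
    qed
    ultimately show ?thesis
      unfolding decidable_def by (elim computable_cong) simp
  qed
  then show ?thesis
    using computable_rec_nat[of n "\<lambda>_. 0" "\<lambda>k r xs. if Q k xs then Suc 0 else r" b,
        OF computable_0 computable_if[OF _ computable_Suc[OF computable_0] computable_tl[OF computable_hd]]]
      assms(2)
    unfolding decidable_def One_nat_def by (simp add: eq[unfolded One_nat_def])
qed

lemma computable_Least:
  assumes "decidable (Suc n) (\<lambda>ys. P (hd ys) (tl ys))"
    and "\<And>xs. length xs = n \<Longrightarrow> \<exists>y. P y xs"
  shows "computable n (\<lambda>xs. LEAST y. P y xs)"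
proof -
  \<comment> \<open>\<open>minimize\<close> looks for a zero, hence the characteristic function of
    the negation.\<close>
  obtain g where g: "recursive_fun (Suc n) g"
      "\<And>ys. length ys = Suc n \<Longrightarrow> g ys = (if \<not> P (hd ys) (tl ys) then 1 else 0)"
    using decidable_not[OF assms(1)] unfolding decidable_def computable_def by blast
  then have eq: "g (y # xs) = 0 \<longleftrightarrow> P y xs" if "length xs = n" for y xs
    using that by simp
  have "recursive_fun n (\<lambda>xs. LEAST y. g (y # xs) = 0)"
    by (rule recursive_fun.minimize) (use g(1) eq assms(2) in auto)
  then show ?thesis
    by (rule computable_cong[OF computable_recursive]) (simp add: eq)
qed

section \<open>Pairs and finite sets coded by numbers\<close>

abbreviation left :: "nat \<Rightarrow> nat" where "left n \<equiv> fst (prod_decode n)"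
abbreviation right :: "nat \<Rightarrow> nat" where "right n \<equiv> snd (prod_decode n)"

lemma computable_prod_encode:
  assumes "computable n f" and "computable n g"
  shows "computable n (\<lambda>xs. prod_encode (f xs, g xs))"
proof -
  have tri: "rec_nat 0 (\<lambda>k r. r + Suc k) l = triangle l" for l by (induction l) auto
  have "computable n (\<lambda>xs. triangle (h xs))" if "computable n h" for h
    using computable_rec_nat[of n "\<lambda>_. 0" "\<lambda>k r xs. r + Suc k" h] that
    unfolding tri by (simp add: computable_0 computable_add computable_Suc computable_tl computable_hd
        del: add_Suc_right)
  then show ?thesis
    using assms by (simp add: prod_encode_def computable_add)
qed

text \<open>Unpairing is found by search. A pair code is at least as large as both of its
  components, which bounds the quantifier over the other component.\<close>

lemma computable_left:
  assumes "computable n f"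
  shows "computable n (\<lambda>xs. left (f xs))"
proof -
  have eq: "left m = (LEAST y. \<exists>z<Suc m. prod_encode (y, z) = m)" for m
    by (rule sym, rule Least_equality)
      (metis le_prod_encode_2 less_Suc_eq_le prod.collapse prod_decode_inverse,
        metis fst_conv order_refl prod_encode_inverse)
  show ?thesis
    unfolding eq
  proof (rule computable_Least)
    show "decidable (Suc n) (\<lambda>ys. \<exists>z<Suc (f (tl ys)). prod_encode (hd ys, z) = f (tl ys))"
      by (intro decidable_bounded_ex decidable_eq computable_prod_encode computable_Suc
          computable_hd computable_tl assms)
    show "\<exists>y. \<exists>z<Suc (f xs). prod_encode (y, z) = f xs" for xs
      by (metis le_prod_encode_2 less_Suc_eq_le prod.collapse prod_decode_inverse)
  qed
qed

lemma computable_right: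
  assumes "computable n f"
  shows "computable n (\<lambda>xs. right (f xs))"
proof -
  have eq: "right m = (LEAST z. prod_encode (left m, z) = m)" for m
    by (rule sym, rule Least_equality) (simp, metis order_refl prod_encode_inverse snd_conv)
  show ?thesis
    unfolding eq
  proof (rule computable_Least)
    show "decidable (Suc n) (\<lambda>ys. prod_encode (left (f (tl ys)), hd ys) = f (tl ys))"
      by (intro decidable_eq computable_prod_encode computable_left computable_hd computable_tl assms)
    show "\<exists>z. prod_encode (left (f xs), z) = f xs" for xs
      by (metis prod.collapse prod_decode_inverse)
  qed
qed

text \<open>Membership says that bit \<open>n\<close> of \<open>s\<close> is set, i.e. that
  \<open>s div 2 ^ n\<close> is odd. Division with remainder expresses this by addition,
  multiplication and powers of 2 under bounded quantifiers.\<close>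

lemma mem_set_decode_iff: "n \<in> set_decode s \<longleftrightarrow> (\<exists>q<Suc s. \<exists>r<2 ^ n. s = (q + q + 1) * 2 ^ n + r)"
proof
  assume "n \<in> set_decode s"
  then obtain q where q: "s div 2 ^ n = q + q + 1"
    by (auto simp: set_decode_def mult_2 elim!: oddE)
  then have s: "s = (q + q + 1) * 2 ^ n + s mod 2 ^ n"
    by (metis div_mult_mod_eq)
  moreover have "q \<le> s"
    using q div_le_dividend[of s "2 ^ n"] by linarith
  ultimately show "\<exists>q<Suc s. \<exists>r<2 ^ n. s = (q + q + 1) * 2 ^ n + r"
    by (metis less_Suc_eq_le mod_less_divisor zero_less_numeral zero_less_power)
next
  assume "\<exists>q<Suc s. \<exists>r<2 ^ n. s = (q + q + 1) * 2 ^ n + r"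
  then obtain q r where "r < 2 ^ n" "s = (q + q + 1) * 2 ^ n + r" by blast
  then have "s div 2 ^ n = q + q + 1"
    by (metis add_cancel_left_right div_less div_mult_self3 mult.commute power_not_zero zero_neq_numeral)
  then show "n \<in> set_decode s" by (simp add: set_decode_def)
qed

text \<open>This bound makes quantification over a coded set a bounded quantification.\<close>

lemma mem_set_decode_less:
  assumes "n \<in> set_decode s"
  shows "n < s"
proof -
  have "2 ^ n \<le> s"
    using assms by (metis div_less even_zero mem_Collect_eq not_le set_decode_def)
  then show ?thesis using less_exp[of n] by linarith
qed

lemma decidable_mem_set_decode:
  assumes "computable n f" and "computable n g"
  shows "decidable n (\<lambda>xs. f xs \<in> set_decode (g xs))"
  unfolding mem_set_decode_iff One_nat_def
  by (intro decidable_bounded_ex decidable_eq computable_Suc computable_add computable_mult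
      computable_power_2 computable_0 computable_hd computable_tl assms)

lemma decidable_Bex_set_decode:
  assumes "decidable (Suc n) (\<lambda>ys. Q (hd ys) (tl ys))" and "computable n b"
  shows "decidable n (\<lambda>xs. \<exists>y\<in>set_decode (b xs). Q y xs)"
proof -
  have "(\<exists>y\<in>set_decode (b xs). Q y xs) \<longleftrightarrow> (\<exists>y<b xs. y \<in> set_decode (b xs) \<and> Q y xs)" for xs
    using mem_set_decode_less by blast
  then show ?thesis
    by (simp only:) (intro decidable_bounded_ex decidable_conj decidable_mem_set_decode
      computable_hd computable_tl assms)
qed

lemma decidable_Ball_set_decode:
  assumes "decidable (Suc n) (\<lambda>ys. Q (hd ys) (tl ys))" and "computable n b"
  shows "decidable n (\<lambda>xs. \<forall>y\<in>set_decode (b xs). Q y xs)"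
  using decidable_not[OF decidable_Bex_set_decode[OF decidable_not[OF assms(1)] assms(2)]] by simp

lemmas decidability_rules =
  decidable_not decidable_conj decidable_disj decidable_imp decidable_le decidable_less
  decidable_eq decidable_Bex_set_decode decidable_Ball_set_decode
  computable_0 computable_add computable_mult computable_left computable_right
  computable_hd computable_tl

section \<open>Monotone systems\<close>

text \<open>
  The functions in \<open>G\<close> preserve \<open>\<rho>\<close>, which measures the position of a value relative to its
  limit. From some stage on, every change is made by a function of \<open>G\<close> that is used infinitely
  often and hence maps limits to limits. From then on the finitely many values of \<open>\<rho>\<close> are only
  permuted or dropped, which leaves finitely many values for each component.
\<close>

lemma monotone_system_stabilizes:
  fixes M :: "nat \<Rightarrow> 'v \<Rightarrow> real" and \<rho> :: "real \<Rightarrow> real \<Rightarrow> real"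
  assumes fin: "finite V" "finite F" "finite G"
    and mono: "\<And>k v. M k v \<le> M (Suc k) v"
    and range: "\<And>k v. M k v \<in> {0..1}"
    and cont: "\<And>g x. g \<in> G \<Longrightarrow> isCont g x"
    and \<rho>: "\<And>g x y. g \<in> G \<Longrightarrow> \<rho> (g x) (g y) = \<rho> x y"
    and inj: "\<And>y. y > 0 \<Longrightarrow> inj (\<lambda>x. \<rho> x y)"
    and step: "\<And>k v. v \<in> V \<Longrightarrow> M (Suc k) v \<noteq> M k v \<Longrightarrow>
      M (Suc k) v \<in> F \<or> (\<exists>g\<in>G. \<exists>u\<in>V. M (Suc k) v = g (M k u))"
  shows "\<exists>k. \<forall>v\<in>V. M (Suc k) v = M k v"
proof (rule ccontr)
  assume never: "\<not> ?thesis"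
  define changes where "changes v k \<longleftrightarrow> M (Suc k) v \<noteq> M k v" for v k
  define I where "I = {v \<in> V. \<exists>\<^sub>F k in sequentially. changes v k}"
  define used where "used = (\<lambda>(v, g, u) k. changes v k \<and> M (Suc k) v = g (M k u))"
  have inc: "incseq (\<lambda>k. M k v)" for v using mono by (rule incseq_SucI)
  define lim where "lim v = (SUP k. M k v)" for v
  have bdd: "bdd_above (range (\<lambda>k. M k v))" for v
    by (rule bdd_aboveI[of _ 1]) (use range in auto)
  have lim: "(\<lambda>k. M k v) \<longlonglongrightarrow> lim v" for v
    unfolding lim_def by (rule LIMSEQ_incseq_SUP[OF bdd inc])
  have le_lim: "M k v \<le> lim v" for k v
    unfolding lim_def by (rule cSUP_upper[OF _ bdd]) simp
  \<comment> \<open>A component that changes infinitely often still grows strictly after every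
    stage, so it never attains its limit.\<close>
  have less_lim: "M k v < lim v" if v: "v \<in> I" for k v
  proof -
    obtain j where "j \<ge> k" "changes v j"
      using v unfolding I_def frequently_sequentially by blast
    then have "M k v < M (Suc j) v"
      using incseqD[OF inc, of k j v] mono[of j v] by (auto simp: changes_def)
    then show ?thesis using le_lim[of "Suc j" v] by linarith
  qed
  have "\<forall>\<^sub>F k in sequentially. \<forall>v\<in>V. changes v k \<longrightarrow> v \<in> I"
    using fin(1) by (auto simp: eventually_ball_finite_distrib I_def frequently_def)
  moreover have "\<forall>\<^sub>F k in sequentially. \<forall>t\<in>V \<times> G \<times> V.
      used t k \<longrightarrow> (\<exists>\<^sub>F k in sequentially. used t k)"
    using fin by (auto simp: eventually_ball_finite_distrib frequently_def)
  moreover have "\<forall>\<^sub>F k in sequentially. \<forall>t\<in>V \<times> F. changes (fst t) k \<longrightarrow> M (Suc k) (fst t) \<noteq> snd t"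
  proof (subst eventually_ball_finite_distrib)
    show "finite (V \<times> F)" using fin by simp
    show "\<forall>t\<in>V \<times> F. \<forall>\<^sub>F k in sequentially. changes (fst t) k \<longrightarrow> M (Suc k) (fst t) \<noteq> snd t"
    proof clarify
      fix v f
      show "\<forall>\<^sub>F k in sequentially. changes (fst (v, f)) k \<longrightarrow> M (Suc k) (fst (v, f)) \<noteq> snd (v, f)"
      proof (cases "\<exists>k. M (Suc k) v = f")
        case True
        then obtain j where j: "M (Suc j) v = f" by blast
        \<comment> \<open>A change after the value \<open>f\<close> was reached leads strictly above
          \<open>f\<close>, so each component jumps to a given constant at most once.\<close>
        have "changes v k \<longrightarrow> M (Suc k) v \<noteq> f" if "k > j" for k
          using incseqD[OF inc, of "Suc j" k v] that mono[of k v] j by (auto simp: changes_def)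
        then show ?thesis by (auto simp: eventually_at_top_dense)
      qed auto
    qed
  qed
  ultimately have "\<forall>\<^sub>F k in sequentially.
      (\<forall>v\<in>V. changes v k \<longrightarrow> v \<in> I) \<and>
      (\<forall>t\<in>V \<times> G \<times> V. used t k \<longrightarrow> (\<exists>\<^sub>F k in sequentially. used t k)) \<and>
      (\<forall>t\<in>V \<times> F. changes (fst t) k \<longrightarrow> M (Suc k) (fst t) \<noteq> snd t)"
    by (intro eventually_conj)
  then obtain K where K: "\<And>k. k \<ge> K \<Longrightarrow>
      (\<forall>v\<in>V. changes v k \<longrightarrow> v \<in> I) \<and>
      (\<forall>t\<in>V \<times> G \<times> V. used t k \<longrightarrow> (\<exists>\<^sub>F k in sequentially. used t k)) \<and>
      (\<forall>t\<in>V \<times> F. changes (fst t) k \<longrightarrow> M (Suc k) (fst t) \<noteq> snd t)"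
    unfolding eventually_sequentially by (elim exE) metis
  have K1: "v \<in> I" if "k \<ge> K" "v \<in> V" "changes v k" for k v
    using K[OF that(1)] that(2,3) by blast
  have K2: "\<exists>\<^sub>F k in sequentially. used (v, g, u) k"
    if "k \<ge> K" "v \<in> V" "g \<in> G" "u \<in> V" "used (v, g, u) k" for k v g u
    using K[OF that(1)] that(2-5) by (metis mem_Sigma_iff)
  have K3: "M (Suc k) v \<notin> F" if "k \<ge> K" "v \<in> V" "changes v k" for k v
    using K[OF that(1)] that(2,3) by (metis fst_conv mem_Sigma_iff snd_conv)
  have const: "M k u = lim u" if "u \<in> V" "u \<notin> I" "k \<ge> K" for u k
  proof -
    have "M (k + i) u = M k u" for i
    proof (induction i)
      case (Suc i)
      then show ?case using K1[of "k + i" u] that by (auto simp: changes_def)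
    qed simp
    then have "(\<lambda>i. M (i + k) u) \<longlonglongrightarrow> M k u" by (simp add: add.commute)
    then show ?thesis
      using LIMSEQ_ignore_initial_segment[OF lim[of u], of k] LIMSEQ_unique by blast
  qed
  \<comment> \<open>The difference of the two sides converges by continuity and vanishes infinitely
    often, so its limit is 0.\<close>
  have limits: "lim v = g (lim u)" if "g \<in> G" "\<exists>\<^sub>F k in sequentially. used (v, g, u) k" for v g u
  proof (rule ccontr)
    assume ne: "lim v \<noteq> g (lim u)"
    have "(\<lambda>k. M (Suc k) v - g (M k u)) \<longlonglongrightarrow> lim v - g (lim u)"
      by (rule tendsto_diff[OF LIMSEQ_Suc[OF lim] isCont_tendsto_compose[OF cont[OF that(1)] lim]])
    then have "\<forall>\<^sub>F k in sequentially. M (Suc k) v - g (M k u) \<noteq> 0"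
      using ne by (intro tendsto_imp_eventually_ne) auto
    then have "\<forall>\<^sub>F k in sequentially. \<not> used (v, g, u) k"
      by eventually_elim (auto simp: used_def)
    then show False using that(2) by (simp add: frequently_def)
  qed
  \<comment> \<open>After stage \<open>K\<close> a change at \<open>v\<close> by \<open>g\<close>
    from \<open>u\<close> gives \<open>v\<close> the \<open>\<rho>\<close>-value that
    \<open>u\<close> had, because \<open>g\<close> also carries the limit of \<open>u\<close> to
    that of \<open>v\<close>. Hence no new \<open>\<rho>\<close>-values arise.\<close>
  define R where "R = (\<lambda>u. \<rho> (M K u) (lim u)) ` I"
  have finI: "finite I" using fin(1) by (simp add: I_def)
  have inR: "\<forall>v\<in>I. \<rho> (M (K + i) v) (lim v) \<in> R" for i
  proof (induction i)
    case 0
    then show ?case by (simp add: R_def)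
  next
    case (Suc i)
    show ?case
    proof
      fix v assume v: "v \<in> I"
      show "\<rho> (M (K + Suc i) v) (lim v) \<in> R"
      proof (cases "changes v (K + i)")
        case False
        then show ?thesis using Suc v by (simp add: changes_def)
      next
        case True
        have "v \<in> V" using v by (simp add: I_def)
        then obtain g u where gu: "g \<in> G" "u \<in> V" "M (Suc (K + i)) v = g (M (K + i) u)"
          using step[of v "K + i"] K3[of "K + i" v] True by (auto simp: changes_def)
        then have l: "lim v = g (lim u)"
          using K2[of "K + i" v g u] \<open>v \<in> V\<close> True by (intro limits) (auto simp: used_def)
        \<comment> \<open>If \<open>u\<close> had settled, its value would be its limit, and the
          change would put \<open>v\<close> at its own limit, contrary to
          \<open>less_lim\<close>.\<close>
        have "u \<in> I"
        proof (rule ccontr)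
          assume "u \<notin> I"
          then show False using const[of u "K + i"] less_lim[OF v, of "Suc (K + i)"] gu l by simp
        qed
        then show ?thesis using Suc gu l \<rho> by simp
      qed
    qed
  qed
  obtain v where v: "v \<in> V" "changes v K" using never by (auto simp: changes_def)
  then have "v \<in> I" using K1 by blast
  \<comment> \<open>Injectivity of \<open>\<rho>\<close> in its first argument is available only for
    a positive second argument; for the product algebra \<open>\<rho>\<close> divides by the
    limit.\<close>
  have "lim v > 0" using less_lim[OF \<open>v \<in> I\<close>, of 0] range[of 0 v] by simp
  have finX: "finite (range (\<lambda>i. M (K + i) v))"
  proof (rule inj_on_finite)
    show "inj_on (\<lambda>x. \<rho> x (lim v)) (range (\<lambda>i. M (K + i) v))"
      using inj[OF \<open>lim v > 0\<close>] inj_on_subset by blast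
    show "(\<lambda>x. \<rho> x (lim v)) ` range (\<lambda>i. M (K + i) v) \<subseteq> R" using inR \<open>v \<in> I\<close> by auto
    show "finite R" using finI by (simp add: R_def)
  qed
  obtain i where i: "Max (range (\<lambda>i. M (K + i) v)) = M (K + i) v"
    using Max_in[OF finX] by auto
  obtain j where j: "j \<ge> K + i" "changes v j"
    using \<open>v \<in> I\<close> unfolding I_def frequently_sequentially by blast
  then have "M (K + i) v < M (Suc j) v"
    using incseqD[OF inc, of "K + i" j v] mono[of j v] by (auto simp: changes_def)
  moreover have "M (K + (Suc j - K)) v \<le> M (K + i) v"
    unfolding i[symmetric] by (rule Max_ge[OF finX]) blast
  ultimately show False using j(1) by simp
qed

section \<open>Provability and semantic closure\<close>

lemma is_proof_append:
  assumes "is_proof L \<Sigma> ps" and "is_proof L \<Sigma> qs"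
  shows "is_proof L \<Sigma> (ps @ qs)"
  unfolding is_proof_def
proof (intro conjI allI impI)
  show "set (ps @ qs) \<subseteq> formulas" using assms by (auto simp: is_proof_def)
  fix i assume i: "i < length (ps @ qs)"
  let ?r = "ps @ qs"
  show "is_axiom (?r ! i) \<or> ?r ! i \<in> \<Sigma> \<or> (\<exists>j<i. \<exists>k<i. by_cut (?r ! j) (?r ! k) (?r ! i)) \<or>
    (\<exists>j<i. by_mul L (?r ! j) (?r ! i))"
  proof (cases "i < length ps")
    case True
    then have eq: "\<And>j. j \<le> i \<Longrightarrow> ?r ! j = ps ! j" by (simp add: nth_append)
    have "is_axiom (ps ! i) \<or> ps ! i \<in> \<Sigma> \<or> (\<exists>j<i. \<exists>k<i. by_cut (ps ! j) (ps ! k) (ps ! i)) \<or>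
      (\<exists>j<i. by_mul L (ps ! j) (ps ! i))"
      using assms(1) True unfolding is_proof_def by blast
    then show ?thesis using eq by (metis less_imp_le order_refl)
  next
    case False
    define i' where "i' = i - length ps"
    have i': "i = length ps + i'" "i' < length qs" using False i by (auto simp: i'_def)
    have eq: "\<And>j. ?r ! (length ps + j) = qs ! j" by simp
    have "is_axiom (qs ! i') \<or> qs ! i' \<in> \<Sigma> \<or> (\<exists>j<i'. \<exists>k<i'. by_cut (qs ! j) (qs ! k) (qs ! i')) \<or>
      (\<exists>j<i'. by_mul L (qs ! j) (qs ! i'))"
      using assms(2) i'(2) unfolding is_proof_def by blast
    then show ?thesis unfolding i'(1) eq by (metis eq nat_add_left_cancel_less)
  qed
qed

lemma is_proof_snoc:
  assumes "is_proof L \<Sigma> ps" and "\<phi> \<in> formulas"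
    and "is_axiom \<phi> \<or> \<phi> \<in> \<Sigma> \<or> (\<exists>\<psi>\<in>set ps. \<exists>\<chi>\<in>set ps. by_cut \<psi> \<chi> \<phi>) \<or> (\<exists>\<psi>\<in>set ps. by_mul L \<psi> \<phi>)"
  shows "is_proof L \<Sigma> (ps @ [\<phi>])"
  unfolding is_proof_def
proof (intro conjI allI impI)
  show "set (ps @ [\<phi>]) \<subseteq> formulas" using assms by (auto simp: is_proof_def)
  fix i assume i: "i < length (ps @ [\<phi>])"
  let ?r = "ps @ [\<phi>]"
  show "is_axiom (?r ! i) \<or> ?r ! i \<in> \<Sigma> \<or> (\<exists>j<i. \<exists>k<i. by_cut (?r ! j) (?r ! k) (?r ! i)) \<or>
    (\<exists>j<i. by_mul L (?r ! j) (?r ! i))"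
  proof (cases "i < length ps")
    case True
    then have eq: "\<And>j. j \<le> i \<Longrightarrow> ?r ! j = ps ! j" by (simp add: nth_append)
    have "is_axiom (ps ! i) \<or> ps ! i \<in> \<Sigma> \<or> (\<exists>j<i. \<exists>k<i. by_cut (ps ! j) (ps ! k) (ps ! i)) \<or>
      (\<exists>j<i. by_mul L (ps ! j) (ps ! i))"
      using assms(1) True unfolding is_proof_def by blast
    then show ?thesis using eq by (metis less_imp_le order_refl)
  next
    case False
    then have i: "i = length ps" using i by simp
    have eq: "\<And>j. j < length ps \<Longrightarrow> ?r ! j = ps ! j" "?r ! length ps = \<phi>"
      by (simp_all add: nth_append)
    have "is_axiom \<phi> \<or> \<phi> \<in> \<Sigma> \<or>
        (\<exists>j<length ps. \<exists>k<length ps. by_cut (ps ! j) (ps ! k) \<phi>) \<or>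
        (\<exists>j<length ps. by_mul L (ps ! j) \<phi>)"
      using assms(3) by (metis in_set_conv_nth)
    then show ?thesis unfolding i eq(2) by (metis eq(1))
  qed
qed

lemma provable_axiom:
  assumes "A \<in> finite_rational_lsets" and "B \<in> finite_rational_lsets" and "B \<le> A"
  shows "provable L \<Sigma> (A, B)"
proof -
  have "lunion A B = A" using assms(3) by (auto simp: lunion_def le_fun_def max_absorb1)
  then have "is_axiom (A, B)" using assms unfolding is_axiom_def by metis
  then have "is_proof L \<Sigma> ([] @ [(A, B)])"
    using assms by (intro is_proof_snoc) (auto simp: is_proof_def formulas_def)
  then show ?thesis unfolding provable_def by (intro exI[of _ "[(A, B)]"]) simp
qed

lemma provable_assumption:
  assumes "\<phi> \<in> \<Sigma>" and "\<phi> \<in> formulas"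
  shows "provable L \<Sigma> \<phi>"
proof -
  have "is_proof L \<Sigma> ([] @ [\<phi>])"
    using assms by (intro is_proof_snoc) (auto simp: is_proof_def)
  then show ?thesis unfolding provable_def by (intro exI[of _ "[\<phi>]"]) simp
qed

lemma lunion_closed:
  "A \<in> finite_rational_lsets \<Longrightarrow> B \<in> finite_rational_lsets \<Longrightarrow> lunion A B \<in> finite_rational_lsets"
  by (auto simp: finite_rational_lsets_def lunion_def max_def intro: finite_subset[of _ "{u. 0 < A u} \<union> {u. 0 < B u}"])

lemma provable_cut:
  assumes "provable L \<Sigma> (A, B)" and "provable L \<Sigma> (lunion B C, D)"
    and "A \<in> finite_rational_lsets" "B \<in> finite_rational_lsets"
      "C \<in> finite_rational_lsets" "D \<in> finite_rational_lsets"
  shows "provable L \<Sigma> (lunion A C, D)"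
proof -
  obtain ps qs where p: "is_proof L \<Sigma> ps" "ps \<noteq> []" "last ps = (A, B)"
    and q: "is_proof L \<Sigma> qs" "qs \<noteq> []" "last qs = (lunion B C, D)"
    using assms(1,2) unfolding provable_def by blast
  have "is_proof L \<Sigma> ((ps @ qs) @ [(lunion A C, D)])"
  proof (rule is_proof_snoc[OF is_proof_append[OF p(1) q(1)]])
    show "(lunion A C, D) \<in> formulas" using assms lunion_closed by (auto simp: formulas_def)
    have "by_cut (last ps) (last qs) (lunion A C, D)"
      unfolding by_cut_def p(3) q(3) using assms by blast
    moreover have "last ps \<in> set (ps @ qs)" "last qs \<in> set (ps @ qs)"
      using last_in_set[OF p(2)] last_in_set[OF q(2)] by auto
    ultimately show "is_axiom (lunion A C, D) \<or> (lunion A C, D) \<in> \<Sigma> \<or>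
      (\<exists>\<psi>\<in>set (ps @ qs). \<exists>\<chi>\<in>set (ps @ qs). by_cut \<psi> \<chi> (lunion A C, D)) \<or>
      (\<exists>\<psi>\<in>set (ps @ qs). by_mul L \<psi> (lunion A C, D))" by blast
  qed
  then show ?thesis unfolding provable_def by (metis append_is_Nil_conv last_snoc not_Cons_self2)
qed

text \<open>Cut against the axiom instance \<open>M \<union> A \<Rightarrow> B\<close>; the union of
  \<open>A\<close> with itself that results is \<open>A\<close>.\<close>

lemma provable_weaken:
  assumes "provable L \<Sigma> (A, M)" and "B \<le> M"
    and "A \<in> finite_rational_lsets" "B \<in> finite_rational_lsets" "M \<in> finite_rational_lsets"
  shows "provable L \<Sigma> (A, B)"
proof -
  have "provable L \<Sigma> (lunion M A, B)"
    using assms lunion_closed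
    by (intro provable_axiom) (auto simp: lunion_def le_fun_def max_def intro: order_trans)
  from provable_cut[OF assms(1) this] assms show ?thesis by (simp add: lunion_def)
qed

text \<open>Start from the axiom \<open>C \<union> B \<Rightarrow> B \<union> C\<close> and use two
  cuts to replace first \<open>C\<close> and then \<open>B\<close> on the left by
  \<open>A\<close>.\<close>

lemma provable_lunion:
  assumes "provable L \<Sigma> (A, B)" and "provable L \<Sigma> (A, C)"
    and "A \<in> finite_rational_lsets" "B \<in> finite_rational_lsets" "C \<in> finite_rational_lsets"
  shows "provable L \<Sigma> (A, lunion B C)"
proof -
  have "provable L \<Sigma> (lunion C B, lunion B C)"
    using assms lunion_closed by (intro provable_axiom) (auto simp: lunion_def le_fun_def)
  from provable_cut[OF assms(2) this] have "provable L \<Sigma> (lunion A B, lunion B C)"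
    using assms lunion_closed by blast
  then have "provable L \<Sigma> (lunion B A, lunion B C)" by (simp add: lunion_def max.commute)
  from provable_cut[OF assms(1) this] assms lunion_closed[OF assms(4,5)]
  show ?thesis by (simp add: lunion_def)
qed

section \<open>Laws of the two algebras\<close>

locale standard_algebra =
  fixes L :: std_algebra
  assumes standard: "L = lukasiewicz_algebra \<or> L = product_algebra"
begin

lemmas L_defs = lukasiewicz_algebra_def product_algebra_def

lemma tensor_closed:
  assumes "c \<in> {0..1}" and "a \<in> {0..1}"
  shows "tensor L c a \<in> {0..1}"
  using assms standard by (auto simp: L_defs mult_le_one)

lemma tensor_unit_rats:
  assumes "c \<in> unit_rats" and "a \<in> unit_rats"
  shows "tensor L c a \<in> unit_rats"
  using assms standard by (auto simp: L_defs mult_le_one max_def)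

lemma tensor_mono:
  assumes "c \<le> c'" "a \<le> a'" "0 \<le> c" "0 \<le> a"
  shows "tensor L c a \<le> tensor L c' a'"
  using assms standard by (auto simp: L_defs intro!: mult_mono)

lemma tensor_assoc:
  assumes "d \<in> {0..1}" "c \<in> {0..1}" "a \<in> {0..1}"
  shows "tensor L d (tensor L c a) = tensor L (tensor L d c) a"
  using assms standard by (auto simp: L_defs max_def)

lemma tensor_0 [simp]: "c \<le> 1 \<Longrightarrow> tensor L c 0 = 0"
  using standard by (auto simp: L_defs)

lemma tensor_1 [simp]: "0 \<le> a \<Longrightarrow> tensor L 1 a = a"
  using standard by (auto simp: L_defs)

lemma tensor_le_right:
  assumes "c \<in> {0..1}" and "a \<in> {0..1}"
  shows "tensor L c a \<le> a"
  using tensor_mono[of c 1 a a] assms by simp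

lemma adjunction:
  assumes "c \<in> {0..1}" and "b \<in> {0..1}" and "0 \<le> m"
  shows "tensor L c b \<le> m \<longleftrightarrow> c \<le> residuum L b m"
proof (cases "L = lukasiewicz_algebra")
  case True
  then show ?thesis using assms by (auto simp: L_defs)
next
  case False
  then have L: "L = product_algebra" using standard by blast
  show ?thesis
  proof (cases "b \<le> m")
    case True
    have "c * b \<le> b" using assms by (auto intro: mult_left_le_one_le)
    then show ?thesis using assms True by (auto simp: L L_defs)
  next
    case False
    then show ?thesis using assms by (auto simp: L L_defs pos_le_divide_eq)
  qed
qed

lemma residuum_unit_rats:
  assumes "b \<in> unit_rats" and "m \<in> unit_rats"
  shows "residuum L b m \<in> unit_rats"
  using assms standard by (auto simp: L_defs min_def)

lemma lscale_closed:
  assumes "c \<in> unit_rats" and "A \<in> finite_rational_lsets"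
  shows "lscale L c A \<in> finite_rational_lsets"
proof -
  have A: "\<And>u. A u \<in> unit_rats" "finite {u. A u > 0}"
    using assms by (auto simp: finite_rational_lsets_def)
  have "\<And>u. lscale L c A u \<in> unit_rats"
    using tensor_unit_rats assms A by (simp add: lscale_def)
  moreover have "{u. lscale L c A u > 0} \<subseteq> {u. A u > 0}"
  proof
    fix u assume "u \<in> {u. lscale L c A u > 0}"
    then have "A u \<noteq> 0" using assms(1) by (auto simp: lscale_def)
    then show "u \<in> {u. A u > 0}" using A(1)[of u] by simp
  qed
  ultimately show ?thesis
    using A(2) finite_subset unfolding finite_rational_lsets_def by blast
qed

lemma provable_mul:
  assumes "provable L \<Sigma> (A, B)" and "c \<in> unit_rats"
    and "A \<in> finite_rational_lsets" "B \<in> finite_rational_lsets"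
  shows "provable L \<Sigma> (lscale L c A, lscale L c B)"
proof -
  obtain ps where p: "is_proof L \<Sigma> ps" "ps \<noteq> []" "last ps = (A, B)"
    using assms(1) unfolding provable_def by blast
  have "is_proof L \<Sigma> (ps @ [(lscale L c A, lscale L c B)])"
  proof (rule is_proof_snoc[OF p(1)])
    show "(lscale L c A, lscale L c B) \<in> formulas"
      using assms lscale_closed by (auto simp: formulas_def)
    have "by_mul L (last ps) (lscale L c A, lscale L c B)"
      unfolding by_mul_def p(3) using assms by blast
    then show "is_axiom (lscale L c A, lscale L c B) \<or> (lscale L c A, lscale L c B) \<in> \<Sigma> \<or>
      (\<exists>\<psi>\<in>set ps. \<exists>\<chi>\<in>set ps. by_cut \<psi> \<chi> (lscale L c A, lscale L c B)) \<or>
      (\<exists>\<psi>\<in>set ps. by_mul L \<psi> (lscale L c A, lscale L c B))"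
      using p(2) last_in_set by blast
  qed
  then show ?thesis unfolding provable_def by (metis append_is_Nil_conv last_snoc not_Cons_self2)
qed

text \<open>
  Equivalent to \<open>S(A, M) \<le> S(B, M)\<close>, that is, to the truth of \<open>A \<Rightarrow> B\<close> in \<open>M\<close> to degree 1.
\<close>

definition models :: "'v lset \<Rightarrow> 'v fml \<Rightarrow> bool" where
  "models M \<phi> \<longleftrightarrow> (\<forall>c\<in>{0..1}. lscale L c (fst \<phi>) \<le> M \<longrightarrow> lscale L c (snd \<phi>) \<le> M)"

section \<open>Soundness, subsethood degrees and saturation\<close>

lemma lscale_lunion:
  assumes "0 \<le> c" "\<And>u. 0 \<le> A u" "\<And>u. 0 \<le> B u"
  shows "lscale L c (lunion A B) = lunion (lscale L c A) (lscale L c B)"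
proof
  fix u
  show "lscale L c (lunion A B) u = lunion (lscale L c A) (lscale L c B) u"
    using tensor_mono[of c c "A u" "B u"] tensor_mono[of c c "B u" "A u"] assms
    by (auto simp: lscale_def lunion_def max_def)
qed

lemma lunion_le_iff: "lunion A B \<le> M \<longleftrightarrow> A \<le> M \<and> B \<le> (M :: 'v lset)"
  by (auto simp: lunion_def le_fun_def)

lemma finite_rational_lsetsD:
  assumes "A \<in> finite_rational_lsets"
  shows "0 \<le> A u" "A u \<le> 1" "A u \<in> {0..1}" "A u \<in> unit_rats" "finite {u. A u > 0}"
  using assms by (auto simp: finite_rational_lsets_def)

text \<open>Induction along the proof. The quantifier over all scalars in \<open>models\<close>
  handles (Mul): scaling by \<open>c\<close> and then by \<open>d\<close> is scaling by
  \<open>d \<otimes> c\<close>. Cut works because scaling distributes over unions.\<close>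

lemma soundness:
  assumes "provable L \<Sigma> \<phi>" and "\<And>\<psi>. \<psi> \<in> \<Sigma> \<Longrightarrow> models M \<psi>"
  shows "models M \<phi>"
proof -
  obtain ps where ps: "is_proof L \<Sigma> ps" "ps \<noteq> []" "last ps = \<phi>"
    using assms(1) unfolding provable_def by blast
  have "models M (ps ! i)" if "i < length ps" for i
    using that
  proof (induction i rule: less_induct)
    case (less i)
    consider (axm) "is_axiom (ps ! i)" | (hyp) "ps ! i \<in> \<Sigma>"
      | (cut) j k where "j < i" "k < i" "by_cut (ps ! j) (ps ! k) (ps ! i)"
      | (mul) j where "j < i" "by_mul L (ps ! j) (ps ! i)"
      using ps(1) less.prems unfolding is_proof_def by blast
    then show ?case
    proof cases
      case axm
      then show ?thesis
        by (auto simp: is_axiom_def models_def lscale_lunion lunion_le_iff finite_rational_lsetsD)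
    next
      case hyp
      then show ?thesis using assms(2) by blast
    next
      case cut
      then have "models M (ps ! j)" "models M (ps ! k)" using less by auto
      then show ?thesis
        using cut(3)
        by (auto simp: by_cut_def models_def lscale_lunion lunion_le_iff finite_rational_lsetsD)
    next
      case mul
      then obtain A B c where m: "A \<in> finite_rational_lsets" "B \<in> finite_rational_lsets"
        "c \<in> unit_rats" "ps ! j = (A, B)" "ps ! i = (lscale L c A, lscale L c B)"
        unfolding by_mul_def by blast
      have assoc: "lscale L d (lscale L c X) = lscale L (tensor L d c) X"
        if "d \<in> {0..1}" "X \<in> finite_rational_lsets" for d X
        using that m(3) tensor_assoc finite_rational_lsetsD(3)[OF that(2)] by (auto simp: lscale_def)
      have "models M (A, B)" using mul less m by force
      then show ?thesis
        unfolding m(5) models_def fst_conv snd_conv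
        using assoc m tensor_closed by (metis IntD1)
    qed
  qed
  then show ?thesis using ps by (metis last_conv_nth length_greater_0_conv diff_less zero_less_one)
qed

text \<open>The infimum S(C, M) as a finite minimum: for nonnegative \<open>M\<close>, points
  outside the support of \<open>C\<close> contribute only 1, and the inserted 1 also covers empty
  support.\<close>

definition subsethood :: "'v lset \<Rightarrow> 'v lset \<Rightarrow> real" where
  "subsethood C M = Min (insert 1 ((\<lambda>u. residuum L (C u) (M u)) ` {u. C u > 0}))"

lemma subsethood_cases:
  assumes "C \<in> finite_rational_lsets"
  obtains "subsethood C M = 1"
    | u where "C u > 0" "subsethood C M = residuum L (C u) (M u)" "residuum L (C u) (M u) < 1"
proof -
  let ?X = "insert 1 ((\<lambda>u. residuum L (C u) (M u)) ` {u. C u > 0})"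
  have fin: "finite ?X" using finite_rational_lsetsD(5)[OF assms] by simp
  have "subsethood C M \<in> ?X" "subsethood C M \<le> 1"
    unfolding subsethood_def by (rule Min_in[OF fin]) (use Min_le[OF fin] in auto)
  then show ?thesis using that by fastforce
qed

lemma subsethood_unit_rats:
  assumes "C \<in> finite_rational_lsets" and "M \<in> finite_rational_lsets"
  shows "subsethood C M \<in> unit_rats"
  using subsethood_cases[OF assms(1), of M]
    residuum_unit_rats[OF finite_rational_lsetsD(4)[OF assms(1)] finite_rational_lsetsD(4)[OF assms(2)]]
  by (metis IntI Rats_1 atLeastAtMost_iff order_refl zero_le_one)

text \<open>Residuation at each point of the support of \<open>C\<close>; elsewhere the scaled value
  is 0.\<close>

lemma lscale_le_iff_le_subsethood:
  assumes "C \<in> finite_rational_lsets" and "M \<in> finite_rational_lsets" and "c \<in> {0..1}"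
  shows "lscale L c C \<le> M \<longleftrightarrow> c \<le> subsethood C M"
proof -
  have fin: "finite (insert 1 ((\<lambda>u. residuum L (C u) (M u)) ` {u. C u > 0}))"
    using finite_rational_lsetsD(5)[OF assms(1)] by simp
  have "lscale L c C \<le> M \<longleftrightarrow> (\<forall>u. tensor L c (C u) \<le> M u)"
    by (simp add: lscale_def le_fun_def)
  also have "\<dots> \<longleftrightarrow> (\<forall>u\<in>{u. C u > 0}. tensor L c (C u) \<le> M u)"
    using finite_rational_lsetsD(1)[OF assms(1)] finite_rational_lsetsD(1)[OF assms(2)] assms(3)
    by (metis atLeastAtMost_iff less_eq_real_def mem_Collect_eq tensor_0)
  also have "\<dots> \<longleftrightarrow> (\<forall>u\<in>{u. C u > 0}. c \<le> residuum L (C u) (M u))"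
    using adjunction[OF assms(3) finite_rational_lsetsD(3)[OF assms(1)] finite_rational_lsetsD(1)[OF assms(2)]]
    by simp
  also have "\<dots> \<longleftrightarrow> c \<le> subsethood C M"
    unfolding subsethood_def using fin assms(3) by (subst Min_ge_iff) auto
  finally show ?thesis .
qed

text \<open>The relation leaves the order of the steps open. Both provability and ranked
  certificates are obtained by induction on how an iterate arose.\<close>

inductive derivable :: "'v fml set \<Rightarrow> 'v lset \<Rightarrow> 'v lset \<Rightarrow> bool" for \<Sigma> A where
  base: "derivable \<Sigma> A A"
| step: "derivable \<Sigma> A M \<Longrightarrow> (C, D) \<in> \<Sigma> \<Longrightarrow>
    derivable \<Sigma> A (lunion M (lscale L (subsethood C M) D))"

lemma derivable_props:
  assumes "derivable \<Sigma> A M" and "\<Sigma> \<subseteq> formulas" and "A \<in> finite_rational_lsets"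
  shows "M \<in> finite_rational_lsets \<and> A \<le> M \<and> provable L \<Sigma> (A, M)"
  using assms(1)
proof induction
  case base
  then show ?case using assms(3) provable_axiom by auto
next
  case (step M C D)
  let ?s = "subsethood C M"
  have CD: "C \<in> finite_rational_lsets" "D \<in> finite_rational_lsets"
    using step assms(2) by (auto simp: formulas_def)
  note M = step.IH
  have s: "?s \<in> unit_rats" using subsethood_unit_rats CD M by blast
  note sC = lscale_closed[OF s CD(1)] and sD = lscale_closed[OF s CD(2)]
  have "lscale L ?s C \<le> M"
    using lscale_le_iff_le_subsethood[of C M ?s] CD M s by simp
  then have "provable L \<Sigma> (A, lscale L ?s C)"
    using provable_weaken M assms(3) sC by blast
  moreover have "provable L \<Sigma> (lscale L ?s C, lscale L ?s D)"
    using provable_mul[OF provable_assumption] step CD s assms(2) by blast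
  \<comment> \<open>The doubled premise fits the form that Cut expects. The first cut adds
    \<open>A\<close> but leaves the scaled \<open>C\<close> on the left; a second cut with the same
    left premise removes it.\<close>
  then have "provable L \<Sigma> (lunion (lscale L ?s C) (lscale L ?s C), lscale L ?s D)"
    by (simp add: lunion_def)
  ultimately have "provable L \<Sigma> (lunion A (lscale L ?s C), lscale L ?s D)"
    using provable_cut assms(3) sC sD by blast
  then have "provable L \<Sigma> (lunion (lscale L ?s C) A, lscale L ?s D)"
    by (simp add: lunion_def max.commute)
  then have "provable L \<Sigma> (lunion A A, lscale L ?s D)"
    using provable_cut[OF \<open>provable L \<Sigma> (A, lscale L ?s C)\<close>] assms(3) sC sD by blast
  then have "provable L \<Sigma> (A, lscale L ?s D)" by (simp add: lunion_def)
  then have "provable L \<Sigma> (A, lunion M (lscale L ?s D))"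
    using provable_lunion M sD assms(3) by blast
  moreover have "M \<le> lunion M (lscale L ?s D)" by (simp add: lunion_def le_fun_def)
  then have "A \<le> lunion M (lscale L ?s D)" using M order_trans by blast
  ultimately show ?case using M sD lunion_closed by blast
qed

definition saturated :: "'v fml set \<Rightarrow> 'v lset \<Rightarrow> bool" where
  "saturated \<Sigma> M \<longleftrightarrow> (\<forall>(C, D)\<in>\<Sigma>. lscale L (subsethood C M) D \<le> M)"

text \<open>A scalar \<open>c\<close> with \<open>c \<otimes> C \<le> M\<close> is at most S(C, M),
  so monotonicity reduces all scalars to this largest one.\<close>

lemma saturated_models:
  assumes "saturated \<Sigma> M" and "\<Sigma> \<subseteq> formulas" and "M \<in> finite_rational_lsets" and "\<phi> \<in> \<Sigma>"
  shows "models M \<phi>"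
proof -
  obtain C D where \<phi>: "\<phi> = (C, D)" by force
  then have CD: "C \<in> finite_rational_lsets" "D \<in> finite_rational_lsets"
    using assms by (auto simp: formulas_def)
  have sat: "lscale L (subsethood C M) D \<le> M"
    using assms(1,4) \<phi> by (auto simp: saturated_def)
  show ?thesis
    unfolding models_def \<phi> fst_conv snd_conv
  proof (intro ballI impI)
    fix c :: real assume c: "c \<in> {0..1}" and le: "lscale L c C \<le> M"
    then have "c \<le> subsethood C M" using lscale_le_iff_le_subsethood CD assms(3) by blast
    then have "lscale L c D \<le> lscale L (subsethood C M) D"
      using c finite_rational_lsetsD(1)[OF CD(2)] by (auto simp: lscale_def le_fun_def intro: tensor_mono)
    then show "lscale L c D \<le> M" using sat by (rule order_trans)
  qed
qed

text \<open>
  If the infimum defining \<open>S(C, M)\<close> is attained at \<open>u\<close>, with \<open>c = C(u)\<close>, and \<open>d = D(v)\<close>, then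
  \<open>S(C, M) \<otimes> D(v)\<close> is the image of \<open>M(u)\<close> under this map.
\<close>

definition transfer :: "real \<times> real \<Rightarrow> real \<Rightarrow> real" where
  "transfer = (\<lambda>(c, d) x. if L = lukasiewicz_algebra then x + (d - c) else x * (d / c))"

text \<open>The first hypothesis excludes the value 1 of the residuum, the second the truncation at
  0 in the Lukasiewicz product. What remains is a translation or a dilation.\<close>

lemma tensor_residuum:
  assumes "residuum L c x < 1" and "tensor L (residuum L c x) d > 0"
  shows "tensor L (residuum L c x) d = transfer (c, d) x"
  using assms standard by (auto simp: transfer_def L_defs split: if_splits)

lemma saturation_exists:
  assumes \<Sigma>: "finite \<Sigma>" "\<Sigma> \<subseteq> formulas" and A: "A \<in> finite_rational_lsets"
  obtains M where "derivable \<Sigma> A M" and "saturated \<Sigma> M"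
proof (rule ccontr)
  assume contra: "\<not> thesis"
  define R where "R M M' \<longleftrightarrow> M' \<noteq> M \<and>
    (\<exists>(C, D)\<in>\<Sigma>. M' = lunion M (lscale L (subsethood C M) D))" for M M'
  have "\<exists>M'. derivable \<Sigma> A M' \<and> R M M'" if "derivable \<Sigma> A M" for M
  proof -
    have "\<not> saturated \<Sigma> M" using contra that \<open>\<And>M. derivable \<Sigma> A M \<Longrightarrow> saturated \<Sigma> M \<Longrightarrow> thesis\<close> by blast
    then obtain C D where CD: "(C, D) \<in> \<Sigma>" "\<not> lscale L (subsethood C M) D \<le> M"
      by (auto simp: saturated_def)
    let ?M' = "lunion M (lscale L (subsethood C M) D)"
    have "?M' \<noteq> M" using CD(2) lunion_le_iff[of M "lscale L (subsethood C M) D" M] by auto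
    then show ?thesis using CD(1) derivable.step[OF that CD(1)] unfolding R_def by blast
  qed
  \<comment> \<open>If no iterate were saturated, dependent choice would give an endless sequence of
    proper steps.\<close>
  then obtain F where F: "\<And>k. derivable \<Sigma> A (F k)" and R: "\<And>k. R (F k) (F (Suc k))"
    using dependent_nat_choice[of "\<lambda>_. derivable \<Sigma> A" "\<lambda>_. R"] derivable.base by metis
  have frl: "F k \<in> finite_rational_lsets" for k
    using derivable_props[OF F \<Sigma>(2) A] by blast
  define V where "V = {u. A u > 0} \<union> (\<Union>\<phi>\<in>\<Sigma>. {u. fst \<phi> u > 0} \<union> {u. snd \<phi> u > 0})"
  \<comment> \<open>Removing 0 keeps the factors \<open>d / c\<close> finite and nonzero, so that
    the dilations preserve quotients.\<close>
  define P where "P = (\<Union>\<phi>\<in>\<Sigma>. fst \<phi> ` V \<union> snd \<phi> ` V) - {0}"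
  have CD: "C \<in> finite_rational_lsets" "D \<in> finite_rational_lsets" if "(C, D) \<in> \<Sigma>" for C D
    using that \<Sigma>(2) by (auto simp: formulas_def)
  have finV: "finite V"
    unfolding V_def using \<Sigma>(1) CD A finite_rational_lsetsD(5) by (fastforce intro!: finite_UN_I)
  then have finP: "finite P" using \<Sigma>(1) by (simp add: P_def)
  have outside: "M u = 0" if "derivable \<Sigma> A M" "u \<notin> V" for M u
    using that(1)
  proof induction
    case base
    then show ?case using that(2) finite_rational_lsetsD(1)[OF A, of u] by (auto simp: V_def)
  next
    case (step M C D)
    have "D u = 0"
      using that(2) step finite_rational_lsetsD(1)[OF CD(2)[OF step(2)], of u] by (force simp: V_def)
    moreover have "subsethood C M \<in> unit_rats"
      using subsethood_unit_rats CD[OF step(2)] derivable_props[OF step(1) \<Sigma>(2) A] by blast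
    ultimately show ?case using step.IH by (simp add: lunion_def lscale_def)
  qed
  have change: "F (Suc k) v \<in> P \<or> (\<exists>g\<in>transfer ` (P \<times> P). \<exists>u\<in>V. F (Suc k) v = g (F k u))"
    if "v \<in> V" "F (Suc k) v \<noteq> F k v" for k v
  proof -
    obtain C D where cd: "(C, D) \<in> \<Sigma>" "F (Suc k) = lunion (F k) (lscale L (subsethood C (F k)) D)"
      using R[of k] unfolding R_def by blast
    let ?s = "subsethood C (F k)"
    have v: "F (Suc k) v = tensor L ?s (D v)" "tensor L ?s (D v) > F k v"
      using cd(2) that(2) by (auto simp: lunion_def lscale_def max_def split: if_splits)
    then have pos: "tensor L ?s (D v) > 0" using finite_rational_lsetsD(1)[OF frl, of k v] by linarith
    have "?s \<in> unit_rats" using subsethood_unit_rats CD[OF cd(1)] frl by blast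
    then have "D v \<noteq> 0" using pos by auto
    then have Dv: "D v \<in> P" using that(1) cd(1) by (force simp: P_def)
    show ?thesis
    \<comment> \<open>With scalar 1 the new value is the constant \<open>D v\<close>; otherwise it
      is transferred from a point where the infimum is attained.\<close>
    proof (rule subsethood_cases[OF CD(1)[OF cd(1)], of "F k"])
      assume "?s = 1"
      then show ?thesis using v(1) Dv finite_rational_lsetsD(1)[OF CD(2)[OF cd(1)]] by simp
    next
      fix u assume u: "C u > 0" "?s = residuum L (C u) (F k u)" "residuum L (C u) (F k u) < 1"
      then have "u \<in> V" using cd(1) by (force simp: V_def)
      then have "C u \<in> P" using cd(1) u(1) by (force simp: P_def)
      have "F (Suc k) v = transfer (C u, D v) (F k u)"
        using tensor_residuum u pos v(1) by simp
      then show ?thesis using \<open>u \<in> V\<close> \<open>C u \<in> P\<close> Dv by blast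
    qed
  qed
  have "\<exists>k. \<forall>v\<in>V. F (Suc k) v = F k v"
  proof (rule monotone_system_stabilizes[where F = P and G = "transfer ` (P \<times> P)" and
        \<rho> = "\<lambda>x y. if L = lukasiewicz_algebra then x - y else x / y"])
    show "F k v \<le> F (Suc k) v" for k v
      using R[of k] unfolding R_def by (auto simp: lunion_def)
    show "F k v \<in> {0..1}" for k v using finite_rational_lsetsD(3)[OF frl] .
    show "isCont g x" if "g \<in> transfer ` (P \<times> P)" for g x
    proof -
      obtain c d where "g = (\<lambda>x. if L = lukasiewicz_algebra then x + (d - c) else x * (d / c))"
        using \<open>g \<in> transfer ` (P \<times> P)\<close> unfolding transfer_def by auto
      then show ?thesis
        by (cases "L = lukasiewicz_algebra")
          (auto simp del: times_divide_eq_right intro!: isCont_mult continuous_const)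
    qed
    show "(if L = lukasiewicz_algebra then g x - g y else g x / g y) =
        (if L = lukasiewicz_algebra then x - y else x / y)" if "g \<in> transfer ` (P \<times> P)" for g x y
      using that by (auto simp: transfer_def P_def)
    show "inj (\<lambda>x. if L = lukasiewicz_algebra then x - y else x / y)" if "y > 0" for y :: real
      using that by (auto simp: inj_on_def)
  qed (use finV finP change in auto)
  then obtain k where "\<forall>v\<in>V. F (Suc k) v = F k v" by blast
  \<comment> \<open>All iterates vanish outside \<open>V\<close>, so constancy on \<open>V\<close>
    makes the whole step trivial, which \<open>R\<close> forbids.\<close>
  then have "F (Suc k) = F k" using outside[OF F] by (metis ext)
  then show False using R[of k] by (simp add: R_def)
qed

text \<open>\<open>M\<close> is a model of the theory that contains \<open>A\<close>, so soundness
  at scalar 1 yields \<open>B \<le> M\<close>. Conversely, weaken the provable formula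
  \<open>A \<Rightarrow> M\<close>.\<close>

lemma provable_iff_le_saturation:
  assumes "\<Sigma> \<subseteq> formulas" "A \<in> finite_rational_lsets" "B \<in> finite_rational_lsets"
    and "derivable \<Sigma> A M" and "saturated \<Sigma> M"
  shows "provable L \<Sigma> (A, B) \<longleftrightarrow> B \<le> M"
proof
  note M = derivable_props[OF assms(4,1,2)]
  have one: "lscale L 1 X = X" if "X \<in> finite_rational_lsets" for X :: "'a lset"
    using finite_rational_lsetsD(1)[OF that] by (auto simp: lscale_def)
  show "B \<le> M" if "provable L \<Sigma> (A, B)"
  proof -
    have "models M (A, B)"
      using soundness[OF that] saturated_models assms M by blast
    then show ?thesis
      using M one assms(2,3) unfolding models_def by (metis atLeastAtMost_iff fst_conv order_refl snd_conv zero_le_one)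
  qed
  show "provable L \<Sigma> (A, B)" if "B \<le> M" using provable_weaken that M assms by blast
qed

lemma provability_degree_attained:
  assumes "\<Sigma> \<in> finite_theories" and "(A, B) \<in> formulas"
  shows "provability_degree L \<Sigma> A B \<in> \<rat> \<and>
    provable L \<Sigma> (A, lscale L (provability_degree L \<Sigma> A B) B)"
proof -
  have \<Sigma>: "finite \<Sigma>" "\<Sigma> \<subseteq> formulas" using assms(1) by (auto simp: finite_theories_def)
  have AB: "A \<in> finite_rational_lsets" "B \<in> finite_rational_lsets"
    using assms(2) by (auto simp: formulas_def)
  obtain M where M: "derivable \<Sigma> A M" "saturated \<Sigma> M"
    using saturation_exists[OF \<Sigma> AB(1)] by blast
  have MF: "M \<in> finite_rational_lsets" using derivable_props[OF M(1) \<Sigma>(2) AB(1)] by blast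
  let ?s = "subsethood B M"
  have s: "?s \<in> unit_rats" using subsethood_unit_rats AB MF by blast
  have iff: "provable L \<Sigma> (A, lscale L c B) \<longleftrightarrow> c \<le> ?s" if "c \<in> unit_rats" for c
    using provable_iff_le_saturation[OF \<Sigma>(2) AB(1) lscale_closed[OF that AB(2)] M]
      lscale_le_iff_le_subsethood[OF AB(2) MF] that by auto
  have "provability_degree L \<Sigma> A B = ?s"
    unfolding provability_degree_def by (rule cSup_eq_maximum) (use s iff in auto)
  then show ?thesis using s iff by auto
qed

end

section \<open>Certificates\<close>

definition rat_val :: "nat \<Rightarrow> real" where
  "rat_val r = real (left r) / real (right r)"

text \<open>Cross-multiplication keeps the comparison within the natural numbers and allows
  unreduced fractions.\<close>

definition rat_le :: "nat \<Rightarrow> nat \<Rightarrow> bool" where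
  "rat_le r s \<longleftrightarrow> left r * right s \<le> left s * right r"

lemma rat_le_iff:
  assumes "right r > 0" and "right s > 0"
  shows "rat_le r s \<longleftrightarrow> rat_val r \<le> rat_val s"
proof -
  have "rat_val r \<le> rat_val s \<longleftrightarrow> real (left r) * real (right s) \<le> real (left s) * real (right r)"
    using assms by (simp add: rat_val_def divide_simps mult.commute)
  also have "\<dots> \<longleftrightarrow> rat_le r s" unfolding rat_le_def by (metis of_nat_le_iff of_nat_mult)
  finally show ?thesis by simp
qed

lemma unit_rat_code_val:
  assumes "x \<in> unit_rats"
  shows "rat_val (unit_rat_code x) = x" "right (unit_rat_code x) > 0"
proof -
  obtain a where a: "x = of_rat a" using assms by (auto elim!: Rats_cases)
  have inv: "the_inv real_of_rat (of_rat a) = a"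
    by (rule the_inv_f_f) (simp add: inj_on_def)
  obtain p q where pq: "quotient_of a = (p, q)" by force
  have q: "q > 0" using pq quotient_of_denom_pos by blast
  have apq: "a = of_int p / of_int q" using pq quotient_of_div by blast
  moreover have "a \<ge> 0" using assms a by auto
  ultimately have p: "p \<ge> 0" using q by (auto simp: zero_le_divide_iff)
  have code: "unit_rat_code x = prod_encode (nat p, nat q)"
    unfolding a unit_rat_code_def inv pq by simp
  show "rat_val (unit_rat_code x) = x" "right (unit_rat_code x) > 0"
    using p q unfolding code rat_val_def unfolding a apq by (simp_all add: of_rat_divide)
qed

context standard_algebra
begin

text \<open>
  For \<open>c > x\<close> and \<open>d \<ge> r\<close> this is the inequality \<open>d \<rightarrow> r \<le> c \<rightarrow> x\<close> between residua, with
  subtractions and divisions cleared.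
\<close>

definition balance :: "real \<Rightarrow> real \<Rightarrow> real \<Rightarrow> real \<Rightarrow> bool" where
  "balance c r x d \<longleftrightarrow> (if L = lukasiewicz_algebra then c + r \<le> x + d else c * r \<le> x * d)"

lemma lukasiewicz_simps:
  assumes "L = lukasiewicz_algebra"
  shows "tensor L a b = max 0 (a + b - 1)" "residuum L a b = min 1 (1 - a + b)"
    "balance c r x d \<longleftrightarrow> c + r \<le> x + d"
  using assms unfolding balance_def by (simp_all add: lukasiewicz_algebra_def)

lemma product_simps:
  assumes "L \<noteq> lukasiewicz_algebra"
  shows "tensor L a b = a * b" "residuum L a b = (if a \<le> b then 1 else b / a)"
    "balance c r x d \<longleftrightarrow> c * r \<le> x * d"
  using assms standard unfolding balance_def by (auto simp: product_algebra_def)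

text \<open>This is \<open>balance\<close> for coded fractions with all four denominators
  cleared.\<close>

definition balance_code :: "nat \<Rightarrow> nat \<Rightarrow> nat \<Rightarrow> nat \<Rightarrow> bool" where
  "balance_code c r x d \<longleftrightarrow> (if L = lukasiewicz_algebra
     then (left c * right r + left r * right c) * (right x * right d)
        \<le> (left x * right d + left d * right x) * (right c * right r)
     else left c * left r * (right x * right d) \<le> left x * left d * (right c * right r))"

lemma balance_code_iff:
  assumes "right c > 0" "right r > 0" "right x > 0" "right d > 0"
  shows "balance_code c r x d \<longleftrightarrow> balance (rat_val c) (rat_val r) (rat_val x) (rat_val d)"
proof -
  have sum: "rat_val s + rat_val t = real (left s * right t + left t * right s) / real (right s * right t)"
    if "right s > 0" "right t > 0" for s t
    using that by (simp add: rat_val_def field_simps)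
  have prod: "rat_val s * rat_val t = real (left s * left t) / real (right s * right t)" for s t
    by (simp add: rat_val_def)
  have le: "real k / real l \<le> real m / real n \<longleftrightarrow> k * n \<le> m * l" if "l > 0" "n > 0" for k l m n
  proof -
    have "real k / real l \<le> real m / real n \<longleftrightarrow> real (k * n) \<le> real (m * l)"
      using that by (simp add: divide_simps mult.commute)
    then show ?thesis by (simp only: of_nat_le_iff)
  qed
  show ?thesis
    unfolding balance_def balance_code_def using assms
    by (simp only: sum prod le nat_0_less_mult_iff if_cancel simp_thms)
qed

text \<open>Used to build positive certificates: the scalar \<open>s\<close> of a derivation step is
  eliminated. Positivity keeps away from the truncated part of the Lukasiewicz product, where
  \<open>s\<close> cannot be recovered from \<open>s \<otimes> d\<close>.\<close>

lemma balance_tensor: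
  assumes "s \<in> {0..1}" "c \<in> {0..1}" "d \<in> {0..1}" "0 \<le> x"
    and "tensor L s c \<le> x" and "tensor L s d > 0"
  shows "balance c (tensor L s d) x d"
proof (cases "L = lukasiewicz_algebra")
  case True
  show ?thesis using assms unfolding lukasiewicz_simps[OF True] by (auto simp: max_def split: if_splits)
next
  case False
  have "s * c * d \<le> x * d"
    using assms unfolding product_simps[OF False] by (intro mult_right_mono) auto
  then show ?thesis unfolding product_simps[OF False] by (simp add: mult_ac)
qed

text \<open>The witness is the residuum \<open>d \<rightarrow> r\<close>. It depends only on
  \<open>d\<close> and \<open>r\<close>, so one scalar serves all entries of the premise at
  once.\<close>

lemma balance_sound:
  assumes "0 < d" "d \<le> 1" "0 \<le> r" "r \<le> d"
  obtains s where "s \<in> {0..1}" "tensor L s d = r"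
    "\<And>c x. c \<in> {0..1} \<Longrightarrow> 0 \<le> x \<Longrightarrow> balance c r x d \<Longrightarrow> tensor L s c \<le> x"
proof (cases "L = lukasiewicz_algebra")
  case True
  show ?thesis
  proof (rule that[of "1 - d + r"])
    show "1 - d + r \<in> {0..1}" "tensor L (1 - d + r) d = r"
      using assms unfolding lukasiewicz_simps[OF True] by auto
    show "tensor L (1 - d + r) c \<le> x" if "0 \<le> x" "balance c r x d" for c x
      using that unfolding lukasiewicz_simps[OF True] by auto
  qed
next
  case False
  show ?thesis
  proof (rule that[of "r / d"])
    show "r / d \<in> {0..1}" "tensor L (r / d) d = r"
      using assms unfolding product_simps[OF False] by auto
    show "tensor L (r / d) c \<le> x" if "balance c r x d" for c x
      using that assms unfolding product_simps[OF False] by (simp add: divide_simps mult_ac)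
  qed
qed

text \<open>Used to build negative certificates: here \<open>c = C(u)\<close> and
  \<open>x = M(u)\<close> at a point where the infimum S(C, M) is attained.\<close>

lemma balance_residuum:
  assumes "0 < c" "residuum L c x < 1" "tensor L (residuum L c x) d \<le> y"
  shows "balance x d y c"
proof (cases "L = lukasiewicz_algebra")
  case True
  show ?thesis using assms unfolding lukasiewicz_simps[OF True] by (auto simp: max_def split: if_splits)
next
  case False
  have "x * d / c \<le> y" using assms unfolding product_simps[OF False] by (auto split: if_splits)
  then show ?thesis using assms(1) unfolding product_simps[OF False] by (simp add: pos_divide_le_eq)
qed

text \<open>The single bound \<open>s \<otimes> c \<le> x\<close> already limits \<open>s\<close>
  enough, so one entry of the premise witnesses the conclusion for every scalar.\<close>

lemma balance_model:
  assumes "s \<in> {0..1}" "0 < c" "0 \<le> d" "0 \<le> y" "tensor L s c \<le> x" "balance x d y c"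
  shows "tensor L s d \<le> y"
proof (cases "L = lukasiewicz_algebra")
  case True
  show ?thesis using assms unfolding lukasiewicz_simps[OF True] by auto
next
  case False
  have "s * c * d \<le> x * d"
    using assms unfolding product_simps[OF False] by (intro mult_right_mono) auto
  also have "\<dots> \<le> y * c" using assms(6) unfolding product_simps[OF False] .
  finally have "(s * d) * c \<le> y * c" by (simp add: mult_ac)
  then show ?thesis using assms(2) unfolding product_simps[OF False] by simp
qed

section \<open>Input codes and certificates as decidable predicates\<close>

definition well_formed_lset :: "nat \<Rightarrow> bool" where
  "well_formed_lset a \<longleftrightarrow> (\<forall>n\<in>set_decode a.
     0 < left (right n) \<and> left (right n) \<le> right (right n) \<and>
     (\<forall>m\<in>set_decode a. left m = left n \<longrightarrow> m = n))"

text \<open>The search must succeed on every number. Numbers that pass this test decode to a genuine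
  finite theory and formula, possibly through unreduced fractions; the others are rejected by the
  test itself.\<close>

definition well_formed :: "nat \<Rightarrow> bool" where
  "well_formed x \<longleftrightarrow> (\<forall>\<phi>\<in>set_decode (left x). well_formed_lset (left \<phi>) \<and> well_formed_lset (right \<phi>)) \<and>
     well_formed_lset (left (right x)) \<and> well_formed_lset (right (right x))"

text \<open>
  A positive certificate \<open>y\<close> codes a set of triples \<open>(k, (u, r))\<close>, each claiming that degree \<open>r\<close>
  can be derived at the variable \<open>u\<close>; the rank \<open>k\<close> makes the justifications well-founded.
\<close>

definition justified :: "nat set \<Rightarrow> nat \<Rightarrow> nat \<Rightarrow> bool" where
  "justified T x t \<longleftrightarrow> 0 < right (right (right t)) \<and>
    (left (right (right t)) = 0 \<or>
     (\<exists>a\<in>set_decode (left (right x)). left a = left (right t) \<and> rat_le (right (right t)) (right a)) \<or>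
     (\<exists>\<phi>\<in>set_decode (left x). \<exists>d\<in>set_decode (right \<phi>).
        left d = left (right t) \<and> rat_le (right (right t)) (right d) \<and>
        (\<forall>c\<in>set_decode (left \<phi>). \<exists>t'\<in>T. left t' < left t \<and> left (right t') = left c \<and>
           balance_code (right c) (right (right t)) (right (right t')) (right d))))"

definition positive_certificate :: "nat \<Rightarrow> nat \<Rightarrow> bool" where
  "positive_certificate y x \<longleftrightarrow>
    (\<forall>t\<in>set_decode y. justified (set_decode y) x t) \<and>
    (\<forall>b\<in>set_decode (right (right x)). \<exists>t\<in>set_decode y.
       left (right t) = left b \<and> rat_le (right b) (right (right t)))"

text \<open>
  A negative certificate \<open>m\<close> codes the graph of a model of the theory on the relevant variables.
\<close>

definition negative_certificate :: "nat \<Rightarrow> nat \<Rightarrow> bool" where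
  "negative_certificate m x \<longleftrightarrow>
    (\<forall>n\<in>set_decode m. 0 < right (right n) \<and> (\<forall>n'\<in>set_decode m. left n' = left n \<longrightarrow> n' = n)) \<and>
    (\<forall>a\<in>set_decode (left (right x)). \<exists>n\<in>set_decode m. left n = left a \<and> rat_le (right a) (right n)) \<and>
    (\<exists>b\<in>set_decode (right (right x)). \<exists>n\<in>set_decode m. left n = left b \<and> \<not> rat_le (right b) (right n)) \<and>
    (\<forall>\<phi>\<in>set_decode (left x). \<forall>d\<in>set_decode (right \<phi>). \<exists>n\<in>set_decode m. left n = left d \<and>
       (rat_le (right d) (right n) \<or>
        (\<exists>c\<in>set_decode (left \<phi>). \<exists>n'\<in>set_decode m. left n' = left c \<and>
           balance_code (right n') (right d) (right n) (right c))))"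

text \<open>The algebra is fixed and not an argument of the procedure, so the choice between the two
  forms of \<open>balance_code\<close> is made outside the computation.\<close>

lemma decidable_if_const:
  assumes "decidable n P" and "decidable n Q"
  shows "decidable n (\<lambda>xs. if C then P xs else Q xs)"
  using assms by (cases C) auto

lemma decidable_rat_le:
  assumes "computable n f" and "computable n g"
  shows "decidable n (\<lambda>xs. rat_le (f xs) (g xs))"
  unfolding rat_le_def by (intro decidability_rules assms)

lemma decidable_balance_code:
  assumes "computable n f" "computable n g" "computable n h" "computable n k"
  shows "decidable n (\<lambda>xs. balance_code (f xs) (g xs) (h xs) (k xs))"
  unfolding balance_code_def by (intro decidable_if_const decidability_rules assms)

lemma decidable_well_formed_lset:
  assumes "computable n f"
  shows "decidable n (\<lambda>xs. well_formed_lset (f xs))"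
  unfolding well_formed_lset_def by (intro decidability_rules assms)

lemma decidable_well_formed:
  assumes "computable n f"
  shows "decidable n (\<lambda>xs. well_formed (f xs))"
  unfolding well_formed_def by (intro decidability_rules decidable_well_formed_lset assms)

lemma decidable_positive_certificate:
  assumes "computable n f" "computable n g"
  shows "decidable n (\<lambda>xs. positive_certificate (f xs) (g xs))"
  unfolding positive_certificate_def justified_def
  by (intro decidability_rules decidable_rat_le decidable_balance_code assms)

lemma decidable_negative_certificate:
  assumes "computable n f" "computable n g"
  shows "decidable n (\<lambda>xs. negative_certificate (f xs) (g xs))"
  unfolding negative_certificate_def
  by (intro decidability_rules decidable_rat_le decidable_balance_code assms)

end

section \<open>Decoding numbers as formulas and theories\<close>

locale coded_algebra = standard_algebra +
  fixes e :: "'v \<Rightarrow> nat"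
  assumes bij_e: "bij e"
begin

text \<open>By surjectivity of \<open>e\<close>, the first component of every coded entry names a
  variable.\<close>

lemma e_cases: obtains v where "n = e v"
  using bij_is_surj[OF bij_e] by (rule surjE)

lemma e_eq_iff [simp]: "e u = e v \<longleftrightarrow> u = v"
  by (rule inj_eq[OF bij_is_inj[OF bij_e]])

text \<open>Codes list only the nonzero values, hence the default 0.\<close>

definition lset_of :: "nat \<Rightarrow> 'v lset" where
  "lset_of a v = (if \<exists>n\<in>set_decode a. left n = e v
     then rat_val (right (THE n. n \<in> set_decode a \<and> left n = e v)) else 0)"

definition formula_of :: "nat \<Rightarrow> 'v fml" where
  "formula_of \<phi> = (lset_of (left \<phi>), lset_of (right \<phi>))"

definition theory_of :: "nat \<Rightarrow> 'v fml set" where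
  "theory_of s = formula_of ` set_decode s"

lemma lset_of_eq:
  assumes "n \<in> set_decode a" "left n = e v"
    and "\<And>m. m \<in> set_decode a \<Longrightarrow> left m = left n \<Longrightarrow> m = n"
  shows "lset_of a v = rat_val (right n)"
proof -
  have "(THE n. n \<in> set_decode a \<and> left n = e v) = n"
    by (rule the_equality) (use assms(1,2) in simp, use assms(2,3) in metis)
  then show ?thesis using assms(1,2) unfolding lset_of_def by auto
qed

lemma lset_of_nonneg: "0 \<le> lset_of a v"
  by (simp add: lset_of_def rat_val_def)

lemma well_formed_lsetD:
  assumes "well_formed_lset a" and "n \<in> set_decode a"
  shows "right (right n) > 0" "rat_val (right n) > 0" "rat_val (right n) \<le> 1"
    and "left n = e v \<Longrightarrow> lset_of a v = rat_val (right n)"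
proof -
  have n: "0 < left (right n)" "left (right n) \<le> right (right n)"
    "\<And>m. m \<in> set_decode a \<Longrightarrow> left m = left n \<Longrightarrow> m = n"
    using assms unfolding well_formed_lset_def by blast+
  then show "right (right n) > 0" "rat_val (right n) > 0" "rat_val (right n) \<le> 1"
    by (auto simp: rat_val_def)
  show "lset_of a v = rat_val (right n)" if "left n = e v"
    using lset_of_eq assms(2) that n(3) by blast
qed

lemma lset_of_pos:
  assumes "well_formed_lset a" and "lset_of a v \<noteq> 0"
  obtains n where "n \<in> set_decode a" "left n = e v" "rat_val (right n) = lset_of a v"
proof -
  obtain n where n: "n \<in> set_decode a" "left n = e v"
    using assms(2) unfolding lset_of_def by (auto split: if_splits)
  then show ?thesis using that well_formed_lsetD(4)[OF assms(1)] by metis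
qed

lemma lset_of_closed:
  assumes "well_formed_lset a"
  shows "lset_of a \<in> finite_rational_lsets"
proof -
  have "lset_of a v \<in> unit_rats" for v
  proof (cases "lset_of a v = 0")
    case False
    then obtain n where n: "n \<in> set_decode a" "rat_val (right n) = lset_of a v"
      by (elim lset_of_pos[OF assms])
    moreover have "rat_val (right n) \<in> \<rat>" by (simp add: rat_val_def)
    ultimately show ?thesis using well_formed_lsetD(2,3)[OF assms n(1)] by auto
  qed simp
  moreover have "{v. lset_of a v > 0} \<subseteq> (\<lambda>n. inv e (left n)) ` set_decode a"
  proof
    fix v assume "v \<in> {v. lset_of a v > 0}"
    then have "lset_of a v \<noteq> 0" by simp
    then obtain n where "n \<in> set_decode a" "left n = e v" by (elim lset_of_pos[OF assms])
    then show "v \<in> (\<lambda>n. inv e (left n)) ` set_decode a"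
      using bij_e by (auto simp: bij_def intro!: image_eqI[of _ _ n])
  qed
  then have "finite {v. lset_of a v > 0}" by (rule finite_subset) simp
  ultimately show ?thesis by (auto simp: finite_rational_lsets_def)
qed

lemma well_formed_closed:
  assumes "well_formed x"
  shows "theory_of (left x) \<in> finite_theories" "formula_of (right x) \<in> formulas"
  using assms unfolding well_formed_def theory_of_def formula_of_def formulas_def finite_theories_def
  by (auto simp: lset_of_closed)

lemma lset_code_correct:
  assumes "A \<in> finite_rational_lsets"
  shows "well_formed_lset (lset_code e A)" "lset_of (lset_code e A) = A"
proof -
  have dec: "set_decode (lset_code e A) = (\<lambda>u. prod_encode (e u, unit_rat_code (A u))) ` {u. A u > 0}"
    unfolding lset_code_def using finite_rational_lsetsD(5)[OF assms] by simp
  note val = unit_rat_code_val[OF finite_rational_lsetsD(4)[OF assms]]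
  have bounds: "0 < left (unit_rat_code (A u)) \<and> left (unit_rat_code (A u)) \<le> right (unit_rat_code (A u))"
    if "A u > 0" for u
  proof -
    have "0 < rat_val (unit_rat_code (A u))" "rat_val (unit_rat_code (A u)) \<le> 1"
      using that val finite_rational_lsetsD(2)[OF assms] by simp_all
    then show ?thesis using val(2)[of u] by (simp add: rat_val_def zero_less_divide_iff)
  qed
  show wf: "well_formed_lset (lset_code e A)"
    unfolding well_formed_lset_def dec using bounds by auto
  show "lset_of (lset_code e A) = A"
  proof
    fix v
    show "lset_of (lset_code e A) v = A v"
    proof (cases "A v > 0")
      case True
      then have "prod_encode (e v, unit_rat_code (A v)) \<in> set_decode (lset_code e A)"
        unfolding dec by blast
      from well_formed_lsetD(4)[OF wf this] val show ?thesis by simp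
    next
      case False
      then have "\<not> (\<exists>n\<in>set_decode (lset_code e A). left n = e v)" unfolding dec by auto
      then show ?thesis
        using False finite_rational_lsetsD(1)[OF assms, of v] unfolding lset_of_def by auto
    qed
  qed
qed

lemma entailment_code_correct:
  assumes "\<Sigma> \<in> finite_theories" and "\<phi> \<in> formulas"
  shows "well_formed (entailment_code e (\<Sigma>, \<phi>))"
    and "theory_of (left (entailment_code e (\<Sigma>, \<phi>))) = \<Sigma>"
    and "formula_of (right (entailment_code e (\<Sigma>, \<phi>))) = \<phi>"
proof -
  have dec: "set_decode (left (entailment_code e (\<Sigma>, \<phi>))) = formula_code e ` \<Sigma>"
    using assms(1) by (simp add: entailment_code_def finite_theories_def)
  have fml: "formula_of (formula_code e \<psi>) = \<psi>"
    "well_formed_lset (left (formula_code e \<psi>))" "well_formed_lset (right (formula_code e \<psi>))"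
    if "\<psi> \<in> formulas" for \<psi>
    using that lset_code_correct by (auto simp: formula_of_def formula_code_def formulas_def)
  have \<Sigma>: "\<Sigma> \<subseteq> formulas" using assms(1) by (simp add: finite_theories_def)
  show "well_formed (entailment_code e (\<Sigma>, \<phi>))"
    unfolding well_formed_def dec using \<Sigma> fml assms(2) by (auto simp: entailment_code_def)
  show "theory_of (left (entailment_code e (\<Sigma>, \<phi>))) = \<Sigma>"
    unfolding theory_of_def dec using \<Sigma> fml(1) by (force simp: image_image)
  show "formula_of (right (entailment_code e (\<Sigma>, \<phi>))) = \<phi>"
    using fml(1) assms(2) by (simp add: entailment_code_def)
qed

section \<open>Soundness and existence of certificates\<close>

lemma positive_certificate_sound:
  assumes "well_formed x" and cert: "positive_certificate y x"
    and models: "\<And>\<psi>. \<psi> \<in> theory_of (left x) \<Longrightarrow> models N \<psi>"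
    and le: "lset_of (left (right x)) \<le> N" and nonneg: "\<And>v. 0 \<le> N v"
  shows "lset_of (right (right x)) \<le> N"
proof -
  have wf: "\<And>\<phi>. \<phi> \<in> set_decode (left x) \<Longrightarrow> well_formed_lset (left \<phi>) \<and> well_formed_lset (right \<phi>)"
    "well_formed_lset (left (right x))" "well_formed_lset (right (right x))"
    using assms(1) by (auto simp: well_formed_def)
  have just: "justified (set_decode y) x t" if "t \<in> set_decode y" for t
    using cert that by (simp add: positive_certificate_def)
  \<comment> \<open>Induction on the rank: every claimed degree holds in every nonnegative model
    \<open>N\<close> of the theory that lies above \<open>A\<close>.\<close>
  have bound: "rat_val (right (right t)) \<le> N v" if "t \<in> set_decode y" "left (right t) = e v" for t v
    using that
  proof (induction "left t" arbitrary: t v rule: less_induct)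
    case less
    let ?r = "right (right t)"
    note J = just[OF less.prems(1), unfolded justified_def]
    have r: "right ?r > 0" using J by blast
    consider "left ?r = 0"
      | a where "a \<in> set_decode (left (right x))" "left a = e v" "rat_le ?r (right a)"
      | \<phi> d where "\<phi> \<in> set_decode (left x)" "d \<in> set_decode (right \<phi>)" "left d = e v"
          "rat_le ?r (right d)"
          "\<And>c. c \<in> set_decode (left \<phi>) \<Longrightarrow> \<exists>t'\<in>set_decode y. left t' < left t \<and>
            left (right t') = left c \<and> balance_code (right c) ?r (right (right t')) (right d)"
      using J less.prems(2) by metis
    then show ?case
    proof cases
      case 1
      then show ?thesis using nonneg by (simp add: rat_val_def)
    next
      case 2
      have "rat_val ?r \<le> rat_val (right a)"
        using 2 r rat_le_iff well_formed_lsetD(1)[OF wf(2)] by blast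
      also have "\<dots> = lset_of (left (right x)) v" using 2 well_formed_lsetD(4)[OF wf(2)] by simp
      also have "\<dots> \<le> N v" using le by (simp add: le_fun_def)
      finally show ?thesis .
    next
      case 3
      let ?C = "lset_of (left \<phi>)" and ?D = "lset_of (right \<phi>)"
      note wfC = wf(1)[OF 3(1), THEN conjunct1] and wfD = wf(1)[OF 3(1), THEN conjunct2]
      note d = well_formed_lsetD[OF wfD 3(2)]
      have "rat_val ?r \<le> rat_val (right d)" using 3 r d(1) rat_le_iff by blast
      moreover have "rat_val ?r \<ge> 0" by (simp add: rat_val_def)
      ultimately obtain s where s: "s \<in> {0..1}" "tensor L s (rat_val (right d)) = rat_val ?r"
        "\<And>c x. c \<in> {0..1} \<Longrightarrow> 0 \<le> x \<Longrightarrow> balance c (rat_val ?r) x (rat_val (right d)) \<Longrightarrow> tensor L s c \<le> x"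
        using balance_sound[of "rat_val (right d)" "rat_val ?r"] d by blast
      \<comment> \<open>The triples of smaller rank bound the scaled premise by \<open>N\<close>.
        Truth of the formula in \<open>N\<close> then bounds the scaled conclusion, whose value at
        \<open>v\<close> is the claimed degree.\<close>
      have "tensor L s (?C u) \<le> N u" for u
      proof (cases "?C u = 0")
        case True
        then show ?thesis using s(1) nonneg by simp
      next
        case False
        then obtain c where c: "c \<in> set_decode (left \<phi>)" "left c = e u" "rat_val (right c) = ?C u"
          by (elim lset_of_pos[OF wfC])
        obtain t' where t': "t' \<in> set_decode y" "left t' < left t" "left (right t') = e u"
          "balance_code (right c) ?r (right (right t')) (right d)"
          using 3(5)[OF c(1)] c(2) by auto
        have "right (right (right t')) > 0" using just[OF t'(1)] by (simp add: justified_def)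
        then have "balance (rat_val (right c)) (rat_val ?r) (rat_val (right (right t'))) (rat_val (right d))"
          using t'(4) balance_code_iff[of "right c" ?r "right (right t')" "right d"] r d(1)
            well_formed_lsetD(1)[OF wfC c(1)] by blast
        then have "tensor L s (?C u) \<le> rat_val (right (right t'))"
          using s(3) c(3) well_formed_lsetD(2,3)[OF wfC c(1)] by (simp add: rat_val_def)
        also have "\<dots> \<le> N u" using less.hyps t' by blast
        finally show ?thesis .
      qed
      then have "lscale L s ?C \<le> N" by (simp add: lscale_def le_fun_def)
      moreover have "models N (?C, ?D)"
        using models 3(1) by (auto simp: theory_of_def formula_of_def)
      ultimately have "lscale L s ?D \<le> N" using s(1) by (auto simp: models_def)
      then have "tensor L s (?D v) \<le> N v" by (simp add: lscale_def le_fun_def)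
      then show ?thesis using d(4)[OF 3(3)] s(2) by simp
    qed
  qed
  show ?thesis
  proof (rule le_funI)
    fix v
    show "lset_of (right (right x)) v \<le> N v"
    proof (cases "lset_of (right (right x)) v = 0")
      case True
      then show ?thesis using nonneg by simp
    next
      case False
      then obtain b where b: "b \<in> set_decode (right (right x))" "left b = e v"
        "rat_val (right b) = lset_of (right (right x)) v"
        by (elim lset_of_pos[OF wf(3)])
      then obtain t where t: "t \<in> set_decode y" "left (right t) = e v" "rat_le (right b) (right (right t))"
        using cert unfolding positive_certificate_def by metis
      have "right (right (right t)) > 0" using just[OF t(1)] by (simp add: justified_def)
      then have "rat_val (right b) \<le> rat_val (right (right t))"
        using t(3) rat_le_iff well_formed_lsetD(1)[OF wf(3) b(1)] by blast
      then show ?thesis using bound[OF t(1,2)] b(3) by simp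
    qed
  qed
qed

lemma justified_mono:
  assumes "justified T x t" and "T \<subseteq> T'"
  shows "justified T' x t"
  using assms unfolding justified_def by blast

text \<open>Induction on the derivation of \<open>M\<close>, maintaining a triple with the current
  degree for each variable in \<open>W\<close>. Since \<open>W\<close> contains the supports of all
  premises, each step finds the triples that it refers to.\<close>

lemma derivable_justified:
  assumes "well_formed x" and "finite W"
    and W: "\<And>C D. (C, D) \<in> theory_of (left x) \<Longrightarrow> {v. C v > 0} \<subseteq> W"
    and "derivable (theory_of (left x)) (lset_of (left (right x))) M"
  shows "\<exists>T. finite T \<and> (\<forall>t\<in>T. justified T x t) \<and>
    (\<forall>w\<in>W. \<exists>t\<in>T. left (right t) = e w \<and> rat_val (right (right t)) = M w)"
  using assms(4)
proof induction
  case base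
  have wf: "well_formed_lset (left (right x))" using assms(1) by (simp add: well_formed_def)
  let ?A = "lset_of (left (right x))"
  let ?T = "(\<lambda>w. prod_encode (0, prod_encode (e w, unit_rat_code (?A w)))) ` W"
  note val = unit_rat_code_val[OF finite_rational_lsetsD(4)[OF lset_of_closed[OF wf]]]
  have "justified ?T x t" if t: "t \<in> ?T" for t
  proof -
    obtain w where w: "t = prod_encode (0, prod_encode (e w, unit_rat_code (?A w)))"
      using t by blast
    have "left (unit_rat_code (?A w)) = 0 \<or>
      (\<exists>a\<in>set_decode (left (right x)). left a = e w \<and> rat_le (unit_rat_code (?A w)) (right a))"
    proof (cases "?A w = 0")
      case True
      then show ?thesis using val[of w] by (simp add: rat_val_def)
    next
      case False
      then obtain a where "a \<in> set_decode (left (right x))" "left a = e w" "rat_val (right a) = ?A w"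
        by (elim lset_of_pos[OF wf])
      then show ?thesis
        using rat_le_iff[of "unit_rat_code (?A w)" "right a"] val well_formed_lsetD(1)[OF wf] by auto
    qed
    then show ?thesis unfolding justified_def w using val by auto
  qed
  moreover have "\<exists>t\<in>?T. left (right t) = e w \<and> rat_val (right (right t)) = ?A w" if "w \<in> W" for w
    using that val by auto
  ultimately show ?case using assms(2) by (intro exI[of _ ?T]) blast
next
  case (step M C D)
  obtain \<phi> where \<phi>: "\<phi> \<in> set_decode (left x)" "C = lset_of (left \<phi>)" "D = lset_of (right \<phi>)"
    using step.hyps(2) by (auto simp: theory_of_def formula_of_def)
  have wfC: "well_formed_lset (left \<phi>)" and wfD: "well_formed_lset (right \<phi>)"
    using assms(1) \<phi>(1) by (auto simp: well_formed_def)
  have CD: "C \<in> finite_rational_lsets" "D \<in> finite_rational_lsets"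
    using lset_of_closed wfC wfD \<phi> by auto
  have M: "M \<in> finite_rational_lsets"
    using derivable_props[OF step.hyps(1)] well_formed_closed[OF assms(1)]
    by (auto simp: finite_theories_def formula_of_def formulas_def)
  let ?s = "subsethood C M"
  let ?M = "lunion M (lscale L ?s D)"
  have s: "?s \<in> unit_rats" using subsethood_unit_rats CD M by blast
  have M': "?M \<in> finite_rational_lsets" using lunion_closed M lscale_closed[OF s] CD by blast
  note val = unit_rat_code_val[OF finite_rational_lsetsD(4)[OF M']]
  obtain T where T: "finite T" "\<forall>t\<in>T. justified T x t"
    "\<forall>w\<in>W. \<exists>t\<in>T. left (right t) = e w \<and> rat_val (right (right t)) = M w"
    using step.IH by blast
  \<comment> \<open>The new rank exceeds all old ones, so every earlier triple may serve as a
    justification.\<close>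
  obtain K where K: "\<And>t. t \<in> T \<Longrightarrow> left t < K"
    using finite_nat_set_iff_bounded[of "left ` T"] T(1) by auto
  \<comment> \<open>Only changed values receive new triples. Such values are positive and come from
    the scaled conclusion, as \<open>balance_tensor\<close> requires.\<close>
  define new where "new w = prod_encode (K, prod_encode (e w, unit_rat_code (?M w)))" for w
  let ?T = "T \<union> new ` {w \<in> W. ?M w \<noteq> M w}"
  have "justified ?T x t" if t: "t \<in> ?T" for t
  proof (cases "t \<in> T")
    case True
    then show ?thesis using T(2) justified_mono by blast
  next
    case False
    then obtain w where w: "t = new w" "?M w \<noteq> M w" using t by blast
    then have Mw: "?M w = tensor L ?s (D w)" "tensor L ?s (D w) > 0"
      using finite_rational_lsetsD(1)[OF M, of w] by (auto simp: lunion_def lscale_def max_def split: if_splits)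
    then have "D w \<noteq> 0" using s by auto
    then obtain d where d: "d \<in> set_decode (right \<phi>)" "left d = e w" "rat_val (right d) = D w"
      using \<phi>(3) by (metis lset_of_pos[OF wfD])
    have dpos: "right (right d) > 0" using well_formed_lsetD(1)[OF wfD d(1)] .
    have "rat_le (unit_rat_code (?M w)) (right d)"
      using tensor_le_right[of ?s "D w"] s finite_rational_lsetsD(3)[OF CD(2), of w]
      unfolding rat_le_iff[OF val(2) dpos] unfolding val(1) unfolding Mw(1) d(3) by blast
    moreover have "\<exists>t'\<in>?T. left t' < K \<and> left (right t') = left c \<and>
        balance_code (right c) (unit_rat_code (?M w)) (right (right t')) (right d)"
      if c: "c \<in> set_decode (left \<phi>)" for c
    proof -
      obtain u where u: "left c = e u" by (rule e_cases)
      have Cu: "C u = rat_val (right c)" "C u > 0"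
        using well_formed_lsetD(2,4)[OF wfC c] u \<phi>(2) by auto
      then have "u \<in> W" using W[OF step.hyps(2)] by blast
      then obtain t' where t': "t' \<in> T" "left (right t') = e u" "rat_val (right (right t')) = M u"
        using T(3) by blast
      have "lscale L ?s C \<le> M" using lscale_le_iff_le_subsethood[OF CD(1) M, of ?s] s by simp
      then have "tensor L ?s (C u) \<le> M u" by (simp add: lscale_def le_fun_def)
      then have "balance (C u) (?M w) (M u) (D w)"
        using balance_tensor[of ?s "C u" "D w" "M u"] s Mw
          finite_rational_lsetsD(3)[OF CD(1), of u] finite_rational_lsetsD(3)[OF CD(2), of w]
          finite_rational_lsetsD(1)[OF M, of u] by auto
      then have "balance_code (right c) (unit_rat_code (?M w)) (right (right t')) (right d)"
        using balance_code_iff[of "right c" "unit_rat_code (?M w)" "right (right t')" "right d"]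
          well_formed_lsetD(1)[OF wfC c] val dpos T(2) t' Cu(1) d(3) by (auto simp: justified_def)
      then show ?thesis using t' K u by auto
    qed
    ultimately have ex: "\<exists>d\<in>set_decode (right \<phi>). left d = e w \<and> rat_le (unit_rat_code (?M w)) (right d) \<and>
        (\<forall>c\<in>set_decode (left \<phi>). \<exists>t'\<in>?T. left t' < K \<and> left (right t') = left c \<and>
           balance_code (right c) (unit_rat_code (?M w)) (right (right t')) (right d))"
      using d(1,2) by blast
    have parts: "left t = K" "left (right t) = e w" "right (right t) = unit_rat_code (?M w)"
      by (simp_all add: w(1) new_def)
    show ?thesis
      unfolding justified_def parts
      by (intro conjI disjI2) (rule val(2), rule bexI[OF _ \<phi>(1)], rule ex)
  qed
  moreover have "\<exists>t\<in>?T. left (right t) = e w \<and> rat_val (right (right t)) = ?M w" if "w \<in> W" for w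
  proof (cases "?M w = M w")
    case True
    then show ?thesis using T(3) that by auto
  next
    case False
    then have "new w \<in> ?T" using that by blast
    moreover have "left (right (new w)) = e w" "rat_val (right (right (new w))) = ?M w"
      using val by (simp_all add: new_def)
    ultimately show ?thesis by blast
  qed
  moreover have "finite ?T" using T(1) assms(2) by simp
  ultimately show ?case by (intro exI[of _ ?T] conjI ballI) simp_all
qed

text \<open>The decoded function \<open>lset_of m\<close> is a countermodel. Its values may exceed
  1, and \<open>soundness\<close> applies to it all the same.\<close>

lemma negative_certificate_sound:
  assumes "well_formed x" and cert: "negative_certificate m x"
  shows "\<not> provable L (theory_of (left x)) (formula_of (right x))"
proof
  assume provable: "provable L (theory_of (left x)) (formula_of (right x))"
  let ?N = "lset_of m" and ?A = "lset_of (left (right x))" and ?B = "lset_of (right (right x))"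
  have wf: "\<And>\<phi>. \<phi> \<in> set_decode (left x) \<Longrightarrow> well_formed_lset (left \<phi>) \<and> well_formed_lset (right \<phi>)"
    "well_formed_lset (left (right x))" "well_formed_lset (right (right x))"
    using assms(1) by (auto simp: well_formed_def)
  have den: "right (right n) > 0" if "n \<in> set_decode m" for n
    using cert that by (simp add: negative_certificate_def)
  have N: "?N v = rat_val (right n)" if "n \<in> set_decode m" "left n = e v" for n v
    using cert that lset_of_eq unfolding negative_certificate_def by blast
  have "models ?N \<psi>" if "\<psi> \<in> theory_of (left x)" for \<psi>
  proof -
    obtain \<phi> where \<phi>: "\<phi> \<in> set_decode (left x)" "\<psi> = (lset_of (left \<phi>), lset_of (right \<phi>))"
      using \<open>\<psi> \<in> theory_of (left x)\<close> by (auto simp: theory_of_def formula_of_def)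
    note wfC = wf(1)[OF \<phi>(1), THEN conjunct1] and wfD = wf(1)[OF \<phi>(1), THEN conjunct2]
    show ?thesis
      unfolding models_def \<phi>(2) fst_conv snd_conv
    proof (intro ballI impI le_funI)
      fix s :: real and v
      assume s: "s \<in> {0..1}" and le: "lscale L s (lset_of (left \<phi>)) \<le> ?N"
      show "lscale L s (lset_of (right \<phi>)) v \<le> ?N v"
      proof (cases "lset_of (right \<phi>) v = 0")
        case True
        then show ?thesis using s lset_of_nonneg by (simp add: lscale_def)
      next
        case False
        then obtain d where d: "d \<in> set_decode (right \<phi>)" "left d = e v"
          "rat_val (right d) = lset_of (right \<phi>) v"
          by (elim lset_of_pos[OF wfD])
        note dv = well_formed_lsetD(1-3)[OF wfD d(1)]
        have "\<exists>n\<in>set_decode m. left n = left d \<and>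
           (rat_le (right d) (right n) \<or>
            (\<exists>c\<in>set_decode (left \<phi>). \<exists>n'\<in>set_decode m. left n' = left c \<and>
               balance_code (right n') (right d) (right n) (right c)))"
          using cert \<phi>(1) d(1) unfolding negative_certificate_def by blast
        then obtain n where n: "n \<in> set_decode m" "left n = e v" and
          alt: "rat_le (right d) (right n) \<or>
            (\<exists>c\<in>set_decode (left \<phi>). \<exists>n'\<in>set_decode m. left n' = left c \<and>
               balance_code (right n') (right d) (right n) (right c))"
          using d(2) by auto
        from alt have "tensor L s (rat_val (right d)) \<le> rat_val (right n)"
        proof
          assume "rat_le (right d) (right n)"
          then have "rat_val (right d) \<le> rat_val (right n)" using rat_le_iff dv(1) den n(1) by blast
          then show ?thesis
            using tensor_le_right[of s "rat_val (right d)"] s dv by simp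
        next
          assume "\<exists>c\<in>set_decode (left \<phi>). \<exists>n'\<in>set_decode m. left n' = left c \<and>
               balance_code (right n') (right d) (right n) (right c)"
          then obtain c n' where c: "c \<in> set_decode (left \<phi>)" "n' \<in> set_decode m" "left n' = left c"
            "balance_code (right n') (right d) (right n) (right c)" by blast
          obtain u where u: "left c = e u" by (rule e_cases)
          note cv = well_formed_lsetD[OF wfC c(1)]
          have "balance (rat_val (right n')) (rat_val (right d)) (rat_val (right n)) (rat_val (right c))"
            using c(4) balance_code_iff den n(1) c(2) dv(1) cv(1) by blast
          moreover have "tensor L s (rat_val (right c)) \<le> rat_val (right n')"
            using le cv(4)[OF u] N[OF c(2), of u] c(3) u by (simp add: lscale_def le_fun_def) metis
          moreover have "0 \<le> rat_val (right n)" by (simp add: rat_val_def)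
          ultimately show ?thesis
            using balance_model[of s "rat_val (right c)" "rat_val (right d)" "rat_val (right n)"] s cv dv
            by simp
        qed
        then show ?thesis using N[OF n] d(3) by (simp add: lscale_def)
      qed
    qed
  qed
  then have "models ?N (formula_of (right x))" using soundness[OF provable] by blast
  \<comment> \<open>At scalar 1 the truth of the formula becomes plain inclusion.\<close>
  then have "lscale L 1 ?A \<le> ?N \<Longrightarrow> lscale L 1 ?B \<le> ?N"
    by (simp add: models_def formula_of_def)
  then have imp: "?A \<le> ?N \<Longrightarrow> ?B \<le> ?N"
    using lset_of_nonneg by (simp add: lscale_def)
  have "?A v \<le> ?N v" for v
  proof (cases "?A v = 0")
    case True
    then show ?thesis using lset_of_nonneg by simp
  next
    case False
    then obtain a where a: "a \<in> set_decode (left (right x))" "left a = e v" "rat_val (right a) = ?A v"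
      by (elim lset_of_pos[OF wf(2)])
    then obtain n where n: "n \<in> set_decode m" "left n = e v" "rat_le (right a) (right n)"
      using cert unfolding negative_certificate_def by metis
    then show ?thesis
      using N[OF n(1,2)] a(3) rat_le_iff den well_formed_lsetD(1)[OF wf(2) a(1)] by metis
  qed
  then have B: "?B \<le> ?N" using imp by (simp add: le_fun_def)
  obtain b n where b: "b \<in> set_decode (right (right x))" "n \<in> set_decode m" "left n = left b"
    "\<not> rat_le (right b) (right n)"
    using cert unfolding negative_certificate_def by blast
  obtain v where v: "left b = e v" by (rule e_cases)
  have "?B v \<le> ?N v" using B by (simp add: le_fun_def)
  then have "rat_val (right b) \<le> rat_val (right n)"
    using N[OF b(2), of v] b(3) v well_formed_lsetD(4)[OF wf(3) b(1) v] by simp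
  then show False
    using b(4) rat_le_iff den[OF b(2)] well_formed_lsetD(1)[OF wf(3) b(1)] by blast
qed

text \<open>One saturated iterate \<open>M\<close> supplies both kinds: its derivation yields a
  positive certificate if \<open>B \<le> M\<close>, and otherwise \<open>M\<close> is itself the
  countermodel.\<close>

lemma certificate_exists:
  assumes "well_formed x"
  shows "\<exists>y. positive_certificate y x \<or> negative_certificate y x"
proof -
  let ?\<Sigma> = "theory_of (left x)" and ?A = "lset_of (left (right x))" and ?B = "lset_of (right (right x))"
  have wf: "\<And>\<phi>. \<phi> \<in> set_decode (left x) \<Longrightarrow> well_formed_lset (left \<phi>) \<and> well_formed_lset (right \<phi>)"
    "well_formed_lset (left (right x))" "well_formed_lset (right (right x))"
    using assms by (auto simp: well_formed_def)
  have \<Sigma>: "finite ?\<Sigma>" "?\<Sigma> \<subseteq> formulas"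
    using well_formed_closed(1)[OF assms] by (auto simp: finite_theories_def)
  have AB: "?A \<in> finite_rational_lsets" "?B \<in> finite_rational_lsets" using lset_of_closed wf by auto
  obtain M where M: "derivable ?\<Sigma> ?A M" "saturated ?\<Sigma> M" using saturation_exists[OF \<Sigma> AB(1)] by blast
  have MF: "M \<in> finite_rational_lsets" "?A \<le> M" using derivable_props[OF M(1) \<Sigma>(2) AB(1)] by auto
  \<comment> \<open>Restricting to the variables that occur keeps either certificate finite.\<close>
  define W where "W = {v. ?A v > 0} \<union> {v. ?B v > 0} \<union>
    (\<Union>\<psi>\<in>?\<Sigma>. {v. fst \<psi> v > 0} \<union> {v. snd \<psi> v > 0})"
  have finW: "finite W"
    unfolding W_def using \<Sigma> AB finite_rational_lsetsD(5) by (fastforce simp: formulas_def)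
  have inW: "v \<in> W" if "well_formed_lset a" "n \<in> set_decode a" "left n = e v"
    "{v. lset_of a v > 0} \<subseteq> W" for a n v
    using well_formed_lsetD(2,4)[OF that(1,2)] that(3,4) by auto
  show ?thesis
  proof (cases "?B \<le> M")
    case True
    obtain T where T: "finite T" "\<forall>t\<in>T. justified T x t"
      "\<forall>w\<in>W. \<exists>t\<in>T. left (right t) = e w \<and> rat_val (right (right t)) = M w"
      using derivable_justified[OF assms finW _ M(1)] by (force simp: W_def)
    have "\<exists>t\<in>T. left (right t) = left b \<and> rat_le (right b) (right (right t))"
      if b: "b \<in> set_decode (right (right x))" for b
    proof -
      obtain v where v: "left b = e v" by (rule e_cases)
      then have "v \<in> W" using inW[OF wf(3) b] by (auto simp: W_def)
      then obtain t where t: "t \<in> T" "left (right t) = e v" "rat_val (right (right t)) = M v"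
        using T(3) by blast
      have "rat_val (right b) \<le> M v"
        using True well_formed_lsetD(4)[OF wf(3) b v] by (simp add: le_fun_def) metis
      moreover have "right (right (right t)) > 0" using T(2) t(1) by (simp add: justified_def)
      ultimately have "rat_le (right b) (right (right t))"
        using rat_le_iff well_formed_lsetD(1)[OF wf(3) b] t(3) by simp
      then show ?thesis using t v by auto
    qed
    then have "positive_certificate (set_encode T) x"
      using T by (simp add: positive_certificate_def)
    then show ?thesis by blast
  next
    case False
    define graph where "graph w = prod_encode (e w, unit_rat_code (M w))" for w
    have graph: "left (graph w) = e w" "rat_val (right (graph w)) = M w" "right (right (graph w)) > 0" for w
      using unit_rat_code_val[OF finite_rational_lsetsD(4)[OF MF(1)]] by (simp_all add: graph_def)
    have "negative_certificate (set_encode (graph ` W)) x"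
      unfolding negative_certificate_def set_encode_inverse[OF finite_imageI[OF finW]]
    proof (intro conjI ballI impI)
      show "0 < right (right n)" if "n \<in> graph ` W" for n using that graph by auto
      show "n' = n" if "n \<in> graph ` W" "n' \<in> graph ` W" "left n' = left n" for n n'
        using that graph(1) by auto
      show "\<exists>n\<in>graph ` W. left n = left a \<and> rat_le (right a) (right n)"
        if a: "a \<in> set_decode (left (right x))" for a
      proof -
        obtain v where v: "left a = e v" by (rule e_cases)
        then have "v \<in> W" using inW[OF wf(2) a] by (auto simp: W_def)
        moreover have "rat_val (right a) \<le> M v"
          using MF(2) well_formed_lsetD(4)[OF wf(2) a v] by (simp add: le_fun_def) metis
        then have "rat_le (right a) (right (graph v))"
          using rat_le_iff well_formed_lsetD(1)[OF wf(2) a] graph by simp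
        ultimately show ?thesis using graph v by auto
      qed
      show "\<exists>b\<in>set_decode (right (right x)). \<exists>n\<in>graph ` W. left n = left b \<and> \<not> rat_le (right b) (right n)"
      proof -
        obtain v where v: "\<not> ?B v \<le> M v" using False by (auto simp: le_fun_def)
        then have "?B v \<noteq> 0" using finite_rational_lsetsD(1)[OF MF(1), of v] by auto
        then obtain b where b: "b \<in> set_decode (right (right x))" "left b = e v" "rat_val (right b) = ?B v"
          by (elim lset_of_pos[OF wf(3)])
        have "v \<in> W" using inW[OF wf(3) b(1,2)] by (auto simp: W_def)
        moreover have "\<not> rat_le (right b) (right (graph v))"
          using rat_le_iff well_formed_lsetD(1)[OF wf(3) b(1)] graph v b(3) by simp
        ultimately show ?thesis
          using graph(1) b(1,2) by (intro bexI[of _ b] bexI[of _ "graph v"]) simp_all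
      qed
      fix \<phi> d assume \<phi>: "\<phi> \<in> set_decode (left x)" and d: "d \<in> set_decode (right \<phi>)"
      let ?C = "lset_of (left \<phi>)" and ?D = "lset_of (right \<phi>)"
      note wfC = wf(1)[OF \<phi>, THEN conjunct1] and wfD = wf(1)[OF \<phi>, THEN conjunct2]
      have \<psi>: "(?C, ?D) \<in> ?\<Sigma>" using \<phi> by (auto simp: theory_of_def formula_of_def)
      then have sub: "{v. ?C v > 0} \<subseteq> W" "{v. ?D v > 0} \<subseteq> W" by (force simp: W_def)+
      have CF: "?C \<in> finite_rational_lsets" using lset_of_closed[OF wfC] .
      obtain v where v: "left d = e v" by (rule e_cases)
      have "v \<in> W" using inW[OF wfD d v sub(2)] .
      note dv = well_formed_lsetD[OF wfD d]
      have "lscale L (subsethood ?C M) ?D \<le> M" using M(2) \<psi> by (auto simp: saturated_def)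
      then have le: "tensor L (subsethood ?C M) (rat_val (right d)) \<le> M v"
        using dv(4)[OF v] by (simp add: lscale_def le_fun_def) metis
      have "rat_le (right d) (right (graph v)) \<or>
        (\<exists>c\<in>set_decode (left \<phi>). \<exists>n'\<in>graph ` W. left n' = left c \<and>
           balance_code (right n') (right d) (right (graph v)) (right c))"
      \<comment> \<open>If S(C, M) is 1, then \<open>M\<close> already contains the entry
        \<open>d\<close>. Otherwise a point where the infimum is attained provides the required
        entry of \<open>C\<close>.\<close>
      proof (rule subsethood_cases[OF CF, of M])
        assume "subsethood ?C M = 1"
        then show ?thesis using le rat_le_iff[of "right d" "right (graph v)"] dv graph by simp
      next
        fix u assume u: "?C u > 0" "subsethood ?C M = residuum L (?C u) (M u)" "residuum L (?C u) (M u) < 1"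
        then obtain c where c: "c \<in> set_decode (left \<phi>)" "left c = e u" "rat_val (right c) = ?C u"
          by (metis less_irrefl lset_of_pos[OF wfC])
        have "u \<in> W" using u(1) sub(1) by blast
        have "balance (M u) (rat_val (right d)) (M v) (?C u)"
          using balance_residuum u le by simp
        then have "balance_code (right (graph u)) (right d) (right (graph v)) (right c)"
          using balance_code_iff[of "right (graph u)" "right d" "right (graph v)" "right c"]
            graph dv(1) well_formed_lsetD(1)[OF wfC c(1)] c(3) by simp
        then show ?thesis using c graph \<open>u \<in> W\<close> by auto
      qed
      then show "\<exists>n\<in>graph ` W. left n = left d \<and>
         (rat_le (right d) (right n) \<or>
          (\<exists>c\<in>set_decode (left \<phi>). \<exists>n'\<in>graph ` W. left n' = left c \<and>
             balance_code (right n') (right d) (right n) (right c)))"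
        using \<open>v \<in> W\<close> graph(1) v by auto
    qed
    then show ?thesis by blast
  qed
qed

section \<open>The decision procedure\<close>

lemma positive_certificate_provable:
  assumes "well_formed x" and "positive_certificate y x"
  shows "provable L (theory_of (left x)) (formula_of (right x))"
proof -
  let ?\<Sigma> = "theory_of (left x)" and ?A = "lset_of (left (right x))" and ?B = "lset_of (right (right x))"
  have \<Sigma>: "finite ?\<Sigma>" "?\<Sigma> \<subseteq> formulas"
    using well_formed_closed(1)[OF assms(1)] by (auto simp: finite_theories_def)
  have AB: "?A \<in> finite_rational_lsets" "?B \<in> finite_rational_lsets"
    using well_formed_closed(2)[OF assms(1)] by (auto simp: formulas_def formula_of_def)
  obtain M where M: "derivable ?\<Sigma> ?A M" "saturated ?\<Sigma> M" using saturation_exists[OF \<Sigma> AB(1)] by blast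
  have MF: "M \<in> finite_rational_lsets" "?A \<le> M" using derivable_props[OF M(1) \<Sigma>(2) AB(1)] by auto
  \<comment> \<open>The semantic soundness of the certificate is applied to the saturated iterate,
    so no formal proof has to be read off from the triples.\<close>
  have "?B \<le> M"
    using positive_certificate_sound[OF assms] saturated_models[OF M(2) \<Sigma>(2) MF(1)] MF
      finite_rational_lsetsD(1)[OF MF(1)] by blast
  then show ?thesis
    using provable_iff_le_saturation[OF \<Sigma>(2) AB M] by (simp add: formula_of_def)
qed

lemma provability_decidable:
  "decidable_on (entailment_code e) (finite_theories \<times> formulas) (\<lambda>(\<Sigma>, \<phi>). provable L \<Sigma> \<phi>)"
proof -
  \<comment> \<open>The last disjunct stops the search at once on malformed numbers, which makes the
    minimization total.\<close>
  define search where
    "search x = (LEAST y. positive_certificate y x \<or> negative_certificate y x \<or> \<not> well_formed x)" for x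
  have hd1: "computable 1 hd" using computable_hd[of 0] by simp
  have "computable 1 (\<lambda>xs. search (hd xs))"
    unfolding search_def
  proof (rule computable_Least)
    show "decidable (Suc 1) (\<lambda>ys. positive_certificate (hd ys) (hd (tl ys)) \<or>
        negative_certificate (hd ys) (hd (tl ys)) \<or> \<not> well_formed (hd (tl ys)))"
      by (intro decidable_disj decidable_not decidable_positive_certificate decidable_negative_certificate
          decidable_well_formed computable_hd computable_tl hd1)
    show "\<exists>y. positive_certificate y (hd xs) \<or> negative_certificate y (hd xs) \<or> \<not> well_formed (hd xs)" for xs
      using certificate_exists by blast
  qed
  then have "decidable 1 (\<lambda>xs. positive_certificate (search (hd xs)) (hd xs))"
    by (intro decidable_positive_certificate hd1)
  then obtain f where f: "recursive_fun 1 f"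
    "\<And>xs. length xs = 1 \<Longrightarrow> f xs = (if positive_certificate (search (hd xs)) (hd xs) then 1 else 0)"
    unfolding decidable_def computable_def by blast
  have "f [entailment_code e (\<Sigma>, \<phi>)] = (if provable L \<Sigma> \<phi> then 1 else 0)"
    if "\<Sigma> \<in> finite_theories" "\<phi> \<in> formulas" for \<Sigma> \<phi>
  proof -
    let ?x = "entailment_code e (\<Sigma>, \<phi>)"
    note x = entailment_code_correct[OF that]
    have "positive_certificate (search ?x) ?x \<or> negative_certificate (search ?x) ?x \<or> \<not> well_formed ?x"
      unfolding search_def by (rule LeastI_ex) (use certificate_exists in blast)
    \<comment> \<open>The code is well formed, so a result that is not a positive certificate is a
      negative one; by soundness of both kinds, testing the result for positivity decides
      provability.\<close>
    then have "positive_certificate (search ?x) ?x \<longleftrightarrow> provable L \<Sigma> \<phi>"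
      using positive_certificate_provable[OF x(1)] negative_certificate_sound[OF x(1)] x by metis
    then show ?thesis using f(2)[of "[?x]"] by simp
  qed
  then show ?thesis unfolding decidable_on_def using f(1) by auto
qed

end

theorem theorem2:
  fixes L :: std_algebra and e :: "'v \<Rightarrow> nat"
  assumes "L = lukasiewicz_algebra \<or> L = product_algebra"
    and "bij e"
  shows "(\<forall>\<Sigma> \<in> finite_theories. \<forall>A B :: 'v lset. (A, B) \<in> formulas \<longrightarrow>
            provability_degree L \<Sigma> A B \<in> \<rat> \<and>
            provable L \<Sigma> (A, lscale L (provability_degree L \<Sigma> A B) B))
       \<and> decidable_on (entailment_code e) (finite_theories \<times> formulas) (\<lambda>(\<Sigma>, \<phi>). provable L \<Sigma> \<phi>)"
proof -
  interpret coded_algebra L e by unfold_locales (rule assms)+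
  show ?thesis using provability_degree_attained provability_decidable by blast
qed

end
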